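(* Let $z^*$ be a KKT point of (NLP) at which MFCQ holds. Let $(z,\lambda)$ be an approximate primal-dual solution with $\delta(z,\lambda)=O(\mu)$, where $\mu>0$, and let $s$ be such that the diagonal matrices $D_{\mathcal{B}}=\Lambda_{\mathcal{B}}^{-1}S_{\mathcal{B}}$ and $D_{\mathcal{N}}^{-1}$, with $D_{\mathcal{N}}=\Lambda_{\mathcal{N}}^{-1}S_{\mathcal{N}}$, have all their diagonal elements positive and of size $\Theta(\mu)$. Let $(w,y)$ solve the perturbed system $$\begin{bmatrix} H(z,\lambda)+\tilde E_{11} & \nabla g_{\mathcal{B}}(z)+\tilde E_{12}\\ \nabla g_{\mathcal{B}}(z)^T+\tilde E_{21} & -D_{\mathcal{B}}+\tilde E_{22}\end{bmatrix}\begin{bmatrix}w\\ y\end{bmatrix}=\begin{bmatrix} r_1\\ \nabla g_{\mathcal{B}}(z^* )^Tr_3+r_4\end{bmatrix},$$ where $H(z,\lambda)=\mathcal{L}_{zz}(z,\lambda)+\nabla g_{\mathcal{N}}(z)D_{\mathcal{N}}^{-1}\nabla g_{\mathcal{N}}(z)^T$, the right-hand side vectors $r_1,r_3\in\mathbb{R}^n$, $r_4\in\mathbb{R}^{|\mathcal{B}|}$ are arbitrary, and the (not necessarily symmetric) perturbations satisfy $$\tilde E_{11}=\delta_{\mathbf u}/\mu+O(\mu),\qquad \tilde E_{21},\tilde E_{12},\tilde E_{22}=\delta_{\mathbf u}.$$ Suppose that for some $\beta>0$: $$\mathbf u/\mu\ll1,\quad \mathbf u\ll1,\qquad \sigma_{\min}(\Sigma)\ge\beta\max(\mu^{1/3},\mathbf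 u/\mu),$$ $$\sigma_{\min}(\hat V^T\mathcal{L}_{zz}(z^*,\lambda^* )\hat V)\ge\beta\max(\mu^{1/3},\mathbf u/\mu)\quad\text{for all }\lambda^*\in\mathcal{S}_\lambda.$$ Then, if $\beta$ is sufficiently large, $$(U^Ty,\hat V^Tw,\hat U^Tw)=O(\|r_1\|+\|r_3\|+\|r_4\|),\qquad V^Ty=O(\|r_1\|+\|r_3\|+\|r_4\|/\mu).$$
   Context: (NLP) is $\min_z\phi(z)$ subject to $g(z)\le0$, where $\phi:\mathbb{R}^n\to\mathbb{R}$ and $g:\mathbb{R}^n\to\mathbb{R}^m$ are twice Lipschitz continuously differentiable. $\mathcal{L}(z,\lambda)=\phi(z)+\lambda^Tg(z)$; $\mathcal{L}_z$, $\mathcal{L}_{zz}$ are its gradient and Hessian in $z$. KKT conditions: $\mathcal{L}_z(z,\lambda)=0$, $g(z)\le0$, $\lambda\ge0$, $\lambda^Tg(z)=0$. $\mathcal{S}_\lambda$ is the (nonempty) set of $\lambda^*$ such that $(z^*,\lambda^* )$ satisfies the KKT conditions, $\mathcal{S}=\{z^*\}\times\mathcal{S}_\lambda$, and $\delta(z,\lambda)$ is the Euclidean distance from $(z,\lambda)$ to $\mathcal{S}$. $\mathcal{B}=\{i:g_i(z^* )=0\}$, $\mathcal{N}=\{1,\dots,m\}\setminus\mathcal{B}$. $\nabla g_{\mathcal{B}}(z)$ (resp. $\nabla g_{\mathcal{N}}(z)$) is the matrix with columns $\nabla g_i(z)$, $i\in\mathcal{B}$ (resp. $i\in\mathcal{N}$).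 $S_{\mathcal{B}},\Lambda_{\mathcal{B}}$ are the diagonal matrices of $s_i,\lambda_i$, $i\in\mathcal{B}$; similarly for $\mathcal{N}$. MFCQ: there is $\bar y$ with $\nabla g_{\mathcal{B}}(z^* )^T\bar y<0$ componentwise (so $\mathcal{S}_\lambda$ is bounded). SVD: $\nabla g_{\mathcal{B}}(z^* )=\begin{bmatrix}\hat U&\hat V\end{bmatrix}\begin{bmatrix}\Sigma&0\\ 0&0\end{bmatrix}\begin{bmatrix}U^T\\ V^T\end{bmatrix}=\hat U\Sigma U^T$ with $[\hat U\ \hat V]$ and $[U\ V]$ orthogonal and $\Sigma$ diagonal with positive diagonal. $\sigma_{\min}(\cdot)$ denotes the smallest eigenvalue (conditions on empty matrices are vacuous). $\mathbf u\ge0$ is the unit roundoff, treated here as a parameter. Conventions: the problem and $z^*$ are fixed. A quantity is "$O(\epsilon)$" if its norm is at most a constant times $\epsilon$; "$\Theta(\epsilon)$" if its size is bounded above and below by positive constant multiples of $\epsilon$; "$\delta_{\mathbf u}$" if its norm is at most a constant times $\mathbf u$. The precise meaning of the statement is: for every choice of the constants implicit in the hypotheses, there exist $\beta_0>0$, $\eta>0$ and $K'>0$, depending only on the problem data and those constants, such that whenever the hypotheses hold with $\beta\ge\beta_0$, $\mathbf u/\mu\le\eta$, $\mathbf u\le\eta$, the conclusions hold with all implied constants equal to $K'$. *)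

theory Defs
  imports "HOL-Analysis.Analysis"
begin

definition grad :: "(real^'n \<Rightarrow> real) \<Rightarrow> real^'n \<Rightarrow> real^'n" where
  "grad f x = (THE D. GDERIV f x :> D)"

definition hessian :: "(real^'n \<Rightarrow> real) \<Rightarrow> real^'n \<Rightarrow> real^'n^'n" where
  "hessian f x = jacobian (grad f) (at x)"

(* Twice Lipschitz continuously differentiable.  The Lipschitz condition on the Hessian is only
   required locally, so functions whose Hessian is globally Lipschitz are covered. *)
definition twice_lipschitz_differentiable :: "(real^'n \<Rightarrow> real) \<Rightarrow> bool" where
  "twice_lipschitz_differentiable f \<longleftrightarrow>
     (\<forall>x. f differentiable (at x)) \<and>
     (\<forall>x. grad f differentiable (at x)) \<and>
     (\<forall>x. \<exists>e>0. \<exists>L. L-lipschitz_on (ball x e) (hessian f))"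

definition lagrangian ::
  "(real^'n \<Rightarrow> real) \<Rightarrow> (real^'n \<Rightarrow> real^'m) \<Rightarrow> real^'n \<Rightarrow> real^'m \<Rightarrow> real" where
  "lagrangian \<phi> g z lam = \<phi> z + lam \<bullet> g z"

definition lagrangian_zz ::
  "(real^'n \<Rightarrow> real) \<Rightarrow> (real^'n \<Rightarrow> real^'m) \<Rightarrow> real^'n \<Rightarrow> real^'m \<Rightarrow> real^'n^'n" where
  "lagrangian_zz \<phi> g z lam = hessian (\<lambda>x. lagrangian \<phi> g x lam) z"

definition KKT ::
  "(real^'n \<Rightarrow> real) \<Rightarrow> (real^'n \<Rightarrow> real^'m) \<Rightarrow> real^'n \<Rightarrow> real^'m \<Rightarrow> bool" where
  "KKT \<phi> g z lam \<longleftrightarrow>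
     grad (\<lambda>x. lagrangian \<phi> g x lam) z = 0 \<and>
     (\<forall>i. g z $ i \<le> 0) \<and> (\<forall>i. lam $ i \<ge> 0) \<and> lam \<bullet> g z = 0"

definition multipliers ::
  "(real^'n \<Rightarrow> real) \<Rightarrow> (real^'n \<Rightarrow> real^'m) \<Rightarrow> real^'n \<Rightarrow> (real^'m) set" where
  "multipliers \<phi> g zs = {lam. KKT \<phi> g zs lam}"

(* The product metric is Euclidean, so this is the Euclidean distance to the primal-dual
   solution set. *)
definition sol_dist ::
  "(real^'n \<Rightarrow> real) \<Rightarrow> (real^'n \<Rightarrow> real^'m) \<Rightarrow> real^'n \<Rightarrow> real^'n \<Rightarrow> real^'m \<Rightarrow> real" where
  "sol_dist \<phi> g zs z lam = infdist (z, lam) ({zs} \<times> multipliers \<phi> g zs)"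

definition active :: "(real^'n \<Rightarrow> real^'m) \<Rightarrow> real^'n \<Rightarrow> 'm set" where
  "active g zs = {i. g zs $ i = 0}"

definition MFCQ :: "(real^'n \<Rightarrow> real^'m) \<Rightarrow> real^'n \<Rightarrow> bool" where
  "MFCQ g zs \<longleftrightarrow> (\<exists>ybar. \<forall>i\<in>active g zs. grad (\<lambda>x. g x $ i) zs \<bullet> ybar < 0)"

(* The cardinality of the active set and the rank of its gradient matrix vary, and either may be 0.
   A matrix with rows indexed by a finite set I and columns by a finite set J is therefore a
   function of row and column index whose values outside I \<times> J are irrelevant; blocks are obtained
   by shrinking the index sets.  The Euclidean norm of a vector indexed by I is L2_set v I. *)

definition mulv :: "'j set \<Rightarrow> ('i \<Rightarrow> 'j \<Rightarrow> real) \<Rightarrow> ('j \<Rightarrow> real) \<Rightarrow> 'i \<Rightarrow> real" where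
  "mulv J A x = (\<lambda>i. \<Sum>j\<in>J. A i j * x j)"

(* transpose of A, times x *)
definition tmulv :: "'i set \<Rightarrow> ('i \<Rightarrow> 'j \<Rightarrow> real) \<Rightarrow> ('i \<Rightarrow> real) \<Rightarrow> 'j \<Rightarrow> real" where
  "tmulv I A x = (\<lambda>j. \<Sum>i\<in>I. A i j * x i)"

(* transpose of P, times M, times P *)
definition congruence :: "'i set \<Rightarrow> ('i \<Rightarrow> 'i \<Rightarrow> real) \<Rightarrow> ('i \<Rightarrow> 'k \<Rightarrow> real) \<Rightarrow> 'k \<Rightarrow> 'k \<Rightarrow> real" where
  "congruence I M P = (\<lambda>k l. \<Sum>i\<in>I. \<Sum>j\<in>I. P i k * M i j * P j l)"

definition diag :: "('i \<Rightarrow> real) \<Rightarrow> 'i \<Rightarrow> 'i \<Rightarrow> real" where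
  "diag d = (\<lambda>i j. if i = j then d i else 0)"

(* Frobenius norm; since all norm bounds below carry unspecified constants and the dimensions are
   fixed by the problem, the choice of matrix norm is immaterial. *)
definition fro_norm :: "'i set \<Rightarrow> 'j set \<Rightarrow> ('i \<Rightarrow> 'j \<Rightarrow> real) \<Rightarrow> real" where
  "fro_norm I J A = L2_set (\<lambda>(i, j). A i j) (I \<times> J)"

definition is_eigenvalue :: "'i set \<Rightarrow> ('i \<Rightarrow> 'i \<Rightarrow> real) \<Rightarrow> real \<Rightarrow> bool" where
  "is_eigenvalue I M e \<longleftrightarrow>
     (\<exists>v. (\<exists>i\<in>I. v i \<noteq> 0) \<and> (\<forall>i\<in>I. mulv I M v i = e * v i))"

(* Only meaningful for symmetric M and nonempty I. *)
definition sigma_min :: "'i set \<Rightarrow> ('i \<Rightarrow> 'i \<Rightarrow> real) \<Rightarrow> real" where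
  "sigma_min I M = (LEAST e. is_eigenvalue I M e)"

definition orthogonal_on :: "'i set \<Rightarrow> 'k set \<Rightarrow> ('i \<Rightarrow> 'k \<Rightarrow> real) \<Rightarrow> bool" where
  "orthogonal_on I K P \<longleftrightarrow>
     card I = card K \<and>
     (\<forall>k\<in>K. \<forall>l\<in>K. (\<Sum>i\<in>I. P i k * P i l) = (if k = l then 1 else 0)) \<and>
     (\<forall>i\<in>I. \<forall>j\<in>I. (\<Sum>k\<in>K. P i k * P j k) = (if i = j then 1 else 0))"

(* A = P S Q^T with P and Q orthogonal and S zero except for its leading block, which is the
   r x r diagonal matrix with entries sig 0, ..., sig (r - 1).
   In [Uhat Vhat] = P, Uhat consists of the columns {..<r} and Vhat of the columns {r..<card I};
   in [U V] = Q, U consists of the columns {..<r} and V of the columns {r..<card J}. *)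
definition is_svd ::
  "'i set \<Rightarrow> 'j set \<Rightarrow> ('i \<Rightarrow> 'j \<Rightarrow> real) \<Rightarrow>
   nat \<Rightarrow> (nat \<Rightarrow> real) \<Rightarrow> ('i \<Rightarrow> nat \<Rightarrow> real) \<Rightarrow> ('j \<Rightarrow> nat \<Rightarrow> real) \<Rightarrow> bool" where
  "is_svd I J A r sig P Q \<longleftrightarrow>
     r \<le> card I \<and> r \<le> card J \<and>
     orthogonal_on I {..<card I} P \<and> orthogonal_on J {..<card J} Q \<and>
     (\<forall>k<r. sig k > 0) \<and>
     (\<forall>i\<in>I. \<forall>j\<in>J. A i j = (\<Sum>k<r. P i k * sig k * Q j k))"

(* Column i is the gradient of the i-th constraint. *)
definition grad_mat :: "(real^'n \<Rightarrow> real^'m) \<Rightarrow> real^'n \<Rightarrow> 'n \<Rightarrow> 'm \<Rightarrow> real" where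
  "grad_mat g z = (\<lambda>j i. grad (\<lambda>x. g x $ i) z $ j)"

(* Diagonal entries of the inverse of Lambda, times S. *)
definition D_entry :: "real^'m \<Rightarrow> real^'m \<Rightarrow> 'm \<Rightarrow> real" where
  "D_entry lam s i = inverse (lam $ i) * s $ i"

definition H_mat ::
  "(real^'n \<Rightarrow> real) \<Rightarrow> (real^'n \<Rightarrow> real^'m) \<Rightarrow> real^'n \<Rightarrow> real^'n \<Rightarrow> real^'m \<Rightarrow> real^'m \<Rightarrow> 'n \<Rightarrow> 'n \<Rightarrow> real"
  where
  "H_mat \<phi> g zs z lam s = (\<lambda>j k. lagrangian_zz \<phi> g z lam $ j $ k +
     (\<Sum>i \<in> - active g zs. grad_mat g z j i * inverse (D_entry lam s i) * grad_mat g z k i))"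

definition perturbed_system ::
  "(real^'n \<Rightarrow> real) \<Rightarrow> (real^'n \<Rightarrow> real^'m) \<Rightarrow> real^'n \<Rightarrow> real^'n \<Rightarrow> real^'m \<Rightarrow> real^'m \<Rightarrow>
   ('n \<Rightarrow> 'n \<Rightarrow> real) \<Rightarrow> ('n \<Rightarrow> 'm \<Rightarrow> real) \<Rightarrow> ('m \<Rightarrow> 'n \<Rightarrow> real) \<Rightarrow> ('m \<Rightarrow> 'm \<Rightarrow> real) \<Rightarrow>
   real^'n \<Rightarrow> real^'n \<Rightarrow> ('m \<Rightarrow> real) \<Rightarrow> real^'n \<Rightarrow> ('m \<Rightarrow> real) \<Rightarrow> bool" where
  "perturbed_system \<phi> g zs z lam s E11 E12 E21 E22 r1 r3 r4 w y \<longleftrightarrow>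
     (let B = active g zs in
       (\<forall>j. mulv UNIV (\<lambda>j k. H_mat \<phi> g zs z lam s j k + E11 j k) (($) w) j
            + mulv B (\<lambda>j i. grad_mat g z j i + E12 j i) y j
          = r1 $ j) \<and>
       (\<forall>i\<in>B. mulv UNIV (\<lambda>i j. grad_mat g z j i + E21 i j) (($) w) i
            + mulv B (\<lambda>i k. - diag (D_entry lam s) i k + E22 i k) y i
          = tmulv UNIV (grad_mat g zs) (($) r3) i + r4 i))"

end

theory Submission
  imports Defs
begin

text \<open>
  Let \<open>A\<close> be the matrix of active constraint gradients at the solution and \<open>M\<close> the Hessian of the
  Lagrangian there, at a multiplier near \<open>\<lambda>\<close>. As \<open>\<Sigma>\<close> and \<open>M\<close> are bounded by problem data, a large \<open>\<beta>\<close>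
  makes \<open>\<mu>\<close> small, and the system becomes a perturbation, of size \<open>O(\<mu>)\<close> outside the (1,1) block and
  small inside it, of
  \<open>M w + A y = r\<^sub>1\<close>, \<open>A\<^sup>T (w - r\<^sub>3) = D y + r\<^sub>4\<close>.
  Testing the second equation with the component of \<open>y\<close> in the null space of \<open>A\<close>, where only \<open>D\<close>, of size
  \<open>\<mu>\<close>, acts, bounds \<open>\<mu> y\<close> by \<open>r\<^sub>4\<close> and \<open>\<mu>\<close> times \<open>w\<close> and \<open>A y\<close>; the first equation bounds \<open>A y\<close>. Then
  \<open>A\<^sup>T (w - r\<^sub>3)\<close> is controlled, so \<open>w - r\<^sub>3\<close> is close to the null space of \<open>A\<^sup>T\<close>, where \<open>M\<close> is coercive, and
  testing the first equation there closes the estimate. The singular vectors enter only through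
  orthogonality: \<open>U\<^sup>T y\<close> does not see the null space of \<open>A\<close>, hence is bounded by a multiple of \<open>A y\<close>.
\<close>

section \<open>Symmetry of second derivatives\<close>

text \<open>The mean value theorem, applied to the increment in direction \<open>v\<close> as it
  moves along \<open>u\<close>, turns the second difference into a difference of gradients at two
  points near \<open>x\<close>. Linearizing both at \<open>x\<close> produces the second-order
  term.\<close>

lemma second_difference_estimate:
  fixes f :: "'a::real_inner \<Rightarrow> real"
  assumes G: "\<And>y. GDERIV f y :> G y"
    and H: "linear H"
    and approx: "\<And>h. norm h \<le> t * (norm u + norm v) \<Longrightarrow> norm (G (x + h) - G x - H h) \<le> e * norm h"
    and "0 < t" "0 \<le> e"
  shows "\<bar>f (x + t *\<^sub>R u + t *\<^sub>R v) - f (x + t *\<^sub>R u) - f (x + t *\<^sub>R v) + f x - t\<^sup>2 * (u \<bullet> H v)\<bar>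
    \<le> t\<^sup>2 * (2 * e * (norm u + norm v)\<^sup>2)"
proof -
  define \<phi> where "\<phi> = (\<lambda>s. f (x + s *\<^sub>R u + t *\<^sub>R v) - f (x + s *\<^sub>R u))"
  have der: "DERIV \<phi> s :> u \<bullet> G (x + s *\<^sub>R u + t *\<^sub>R v) - u \<bullet> G (x + s *\<^sub>R u)" for s
  proof -
    have "((\<lambda>s. f (x + s *\<^sub>R u + t *\<^sub>R v)) has_derivative (\<lambda>h. (h *\<^sub>R u) \<bullet> G (x + s *\<^sub>R u + t *\<^sub>R v))) (at s)"
      by (rule has_derivative_compose[of "\<lambda>s. x + s *\<^sub>R u + t *\<^sub>R v" _ _ _ f])
        (use G in \<open>auto simp: gderiv_def intro!: derivative_eq_intros\<close>)
    moreover have "((\<lambda>s. f (x + s *\<^sub>R u)) has_derivative (\<lambda>h. (h *\<^sub>R u) \<bullet> G (x + s *\<^sub>R u))) (at s)"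
      by (rule has_derivative_compose[of "\<lambda>s. x + s *\<^sub>R u" _ _ _ f])
        (use G in \<open>auto simp: gderiv_def intro!: derivative_eq_intros\<close>)
    ultimately have "(\<phi> has_derivative (\<lambda>h. (h *\<^sub>R u) \<bullet> G (x + s *\<^sub>R u + t *\<^sub>R v) - (h *\<^sub>R u) \<bullet> G (x + s *\<^sub>R u))) (at s)"
      unfolding \<phi>_def by (rule has_derivative_diff)
    then show ?thesis
      unfolding has_field_derivative_def by (rule has_derivative_subst) (auto simp: algebra_simps)
  qed
  obtain s where s: "0 < s" "s < t"
    and mv: "\<phi> t - \<phi> 0 = (t - 0) * (u \<bullet> G (x + s *\<^sub>R u + t *\<^sub>R v) - u \<bullet> G (x + s *\<^sub>R u))"
    using MVT2[of 0 t \<phi> "\<lambda>s. u \<bullet> G (x + s *\<^sub>R u + t *\<^sub>R v) - u \<bullet> G (x + s *\<^sub>R u)"] der \<open>0 < t\<close> by auto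
  \<comment> \<open>\<open>a\<close> and \<open>b\<close> are the linearization errors of
    \<open>G\<close> at the two points; the linear parts differ by exactly
    \<open>t *\<^sub>R H v\<close>, whatever the intermediate value \<open>s\<close> is.\<close>
  define a where "a = G (x + (s *\<^sub>R u + t *\<^sub>R v)) - G x - H (s *\<^sub>R u + t *\<^sub>R v)"
  define b where "b = G (x + s *\<^sub>R u) - G x - H (s *\<^sub>R u)"
  have su: "norm (s *\<^sub>R u) \<le> t * norm u" "norm (t *\<^sub>R v) \<le> t * norm v"
    using s by (auto intro: mult_right_mono)
  have n1: "norm (s *\<^sub>R u + t *\<^sub>R v) \<le> t * (norm u + norm v)"
    using norm_triangle_ineq[of "s *\<^sub>R u" "t *\<^sub>R v"] su by (simp add: algebra_simps)
  have n2: "norm (s *\<^sub>R u) \<le> t * (norm u + norm v)"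
    using su s by (smt (verit) mult_nonneg_nonneg norm_ge_zero distrib_left)
  have na: "norm a \<le> e * (t * (norm u + norm v))"
    using approx[OF n1] n1 \<open>0 \<le> e\<close> unfolding a_def by (meson mult_left_mono order_trans)
  have nb: "norm b \<le> e * (t * (norm u + norm v))"
    using approx[OF n2] n2 \<open>0 \<le> e\<close> unfolding b_def by (meson mult_left_mono order_trans)
  have lin: "H (s *\<^sub>R u + t *\<^sub>R v) = H (s *\<^sub>R u) + t *\<^sub>R H v"
    using H by (simp add: linear_add linear_scale)
  have "f (x + t *\<^sub>R u + t *\<^sub>R v) - f (x + t *\<^sub>R u) - f (x + t *\<^sub>R v) + f x = \<phi> t - \<phi> 0"
    by (simp add: \<phi>_def)
  also have "\<dots> = t * (u \<bullet> (a - b + t *\<^sub>R H v))"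
    unfolding mv by (simp add: a_def b_def lin inner_diff_right inner_add_right add.assoc)
  finally have "f (x + t *\<^sub>R u + t *\<^sub>R v) - f (x + t *\<^sub>R u) - f (x + t *\<^sub>R v) + f x - t\<^sup>2 * (u \<bullet> H v)
      = t * (u \<bullet> (a - b))"
    by (simp add: inner_add_right power2_eq_square algebra_simps)
  moreover have "\<bar>u \<bullet> (a - b)\<bar> \<le> t * (2 * e * (norm u + norm v)\<^sup>2)"
  proof -
    have "\<bar>u \<bullet> (a - b)\<bar> \<le> norm u * norm (a - b)" by (rule Cauchy_Schwarz_ineq2)
    also have "\<dots> \<le> (norm u + norm v) * (2 * (e * (t * (norm u + norm v))))"
      using na nb norm_triangle_ineq4[of a b] by (intro mult_mono) auto
    finally show ?thesis by (simp add: power2_eq_square algebra_simps)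
  qed
  ultimately show ?thesis
    using \<open>0 < t\<close> by (simp add: abs_mult power2_eq_square mult.assoc)
qed

text \<open>The second difference of \<open>f\<close> along \<open>u\<close> and \<open>v\<close> is symmetric in \<open>u\<close> and \<open>v\<close>, and it is
  approximated by either of the two bilinear expressions.\<close>
lemma second_derivative_symmetric:
  fixes f :: "'a::real_inner \<Rightarrow> real"
  assumes G: "\<And>y. GDERIV f y :> G y"
    and H: "(G has_derivative H) (at x)"
  shows "u \<bullet> H v = v \<bullet> H u"
proof -
  let ?N = "norm u + norm v"
  have lin: "linear H" using H by (rule has_derivative_linear)
  have bound: "\<bar>u \<bullet> H v - v \<bullet> H u\<bar> \<le> e * (4 * ?N\<^sup>2)" if "e > 0" for e
  proof -
    obtain d where "d > 0" and d: "\<And>y. norm (y - x) < d \<Longrightarrow> norm (G y - G x - H (y - x)) \<le> e * norm (y - x)"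
      using H \<open>e > 0\<close> unfolding has_derivative_at_alt by blast
    \<comment> \<open>Increments of norm at most \<open>t * ?N\<close> then stay within the radius
      \<open>d\<close>; the summand 1 covers \<open>u = v = 0\<close>.\<close>
    define t where "t = d / (2 * (1 + ?N))"
    have pos: "1 + ?N > 0" by (smt (verit) norm_ge_zero)
    have "t > 0" using \<open>d > 0\<close> pos by (simp add: t_def)
    have "t * ?N \<le> t * (1 + ?N)" using \<open>t > 0\<close> by simp
    also have "\<dots> = d / 2" using pos by (simp add: t_def field_simps)
    also have "\<dots> < d" using \<open>d > 0\<close> by simp
    finally have tN: "t * ?N < d" .
    have ap: "norm (G (x + h) - G x - H h) \<le> e * norm h" if "norm h \<le> t * ?N" for h
      using d[of "x + h"] that tN by simp
    have "\<bar>f (x + t *\<^sub>R u + t *\<^sub>R v) - f (x + t *\<^sub>R u) - f (x + t *\<^sub>R v) + f x - t\<^sup>2 * (u \<bullet> H v)\<bar>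
      \<le> t\<^sup>2 * (2 * e * ?N\<^sup>2)"
      using second_difference_estimate[OF G lin ap] \<open>t > 0\<close> \<open>e > 0\<close> by simp
    moreover have "\<bar>f (x + t *\<^sub>R v + t *\<^sub>R u) - f (x + t *\<^sub>R v) - f (x + t *\<^sub>R u) + f x - t\<^sup>2 * (v \<bullet> H u)\<bar>
      \<le> t\<^sup>2 * (2 * e * (norm v + norm u)\<^sup>2)"
      using second_difference_estimate[OF G lin, of t v u x e] ap \<open>t > 0\<close> \<open>e > 0\<close>
      by (simp add: add.commute)
    ultimately have "\<bar>t\<^sup>2 * (u \<bullet> H v) - t\<^sup>2 * (v \<bullet> H u)\<bar> \<le> t\<^sup>2 * (2 * e * ?N\<^sup>2) + t\<^sup>2 * (2 * e * ?N\<^sup>2)"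
      unfolding add.commute[of "norm v"] by (simp add: ac_simps abs_if split: if_splits)
    moreover have "\<bar>t\<^sup>2 * (u \<bullet> H v) - t\<^sup>2 * (v \<bullet> H u)\<bar> = t\<^sup>2 * \<bar>u \<bullet> H v - v \<bullet> H u\<bar>"
      by (simp add: right_diff_distrib[symmetric] abs_mult)
    ultimately have "t\<^sup>2 * \<bar>u \<bullet> H v - v \<bullet> H u\<bar> \<le> t\<^sup>2 * (e * (4 * ?N\<^sup>2))"
      by (simp only: mult_ac)
    then show ?thesis using \<open>t > 0\<close> by simp
  qed
  have "\<bar>u \<bullet> H v - v \<bullet> H u\<bar> \<le> 0 + e" if "e > 0" for e
  proof -
    have p: "1 + 4 * ?N\<^sup>2 > 0" by (simp add: add_pos_nonneg)
    have "\<bar>u \<bullet> H v - v \<bullet> H u\<bar> \<le> e / (1 + 4 * ?N\<^sup>2) * (4 * ?N\<^sup>2)"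
      using bound[of "e / (1 + 4 * ?N\<^sup>2)"] p that by simp
    also have "\<dots> \<le> e"
      using p that by (simp add: field_simps)
    finally show ?thesis by simp
  qed
  then show ?thesis
    using field_le_epsilon[of "\<bar>u \<bullet> H v - v \<bullet> H u\<bar>" 0] by simp
qed

section \<open>Estimates for perturbed saddle point systems\<close>

text \<open>On the orthogonal complement of its kernel \<open>f\<close> is injective, hence bounded
  below in finite dimension; \<open>p\<close> is the orthogonal projection of \<open>x\<close> onto
  the kernel. The constant depends on \<open>f\<close> alone, so for the active gradients at the
  solution it is problem data.\<close>

lemma kernel_distance_bound:
  fixes f :: "'a::euclidean_space \<Rightarrow> 'b::euclidean_space"
  assumes "linear f"
  shows "\<exists>c>0. \<forall>x. \<exists>p. f p = 0 \<and> norm (x - p) \<le> c * norm (f x)"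
proof -
  define N where "N = {x. f x = 0}"
  define S where "S = {x. \<forall>y\<in>N. orthogonal y x}"
  have sN: "subspace N" unfolding N_def using assms by (rule linear_subspace_kernel)
  have sS: "subspace S"
    unfolding S_def by (auto simp: subspace_def orthogonal_def inner_add_right)
  have "x = 0" if "x \<in> S" "f x = 0" for x
    using that by (auto simp: S_def N_def orthogonal_self)
  then obtain e where "e > 0" and e: "\<And>x. x \<in> S \<Longrightarrow> norm (f x) \<ge> e * norm x"
    using injective_imp_isometric[OF closed_subspace[OF sS] sS, of f] assms
    by (auto simp: linear_conv_bounded_linear)
  show ?thesis
  proof (intro exI[of _ "1/e"] conjI allI)
    fix x
    obtain p z where "p \<in> span N" and z: "\<And>w. w \<in> span N \<Longrightarrow> orthogonal z w" and x: "x = p + z"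
      using orthogonal_subspace_decomp_exists[of N x] by metis
    then have p: "f p = 0" using sN by (metis N_def mem_Collect_eq span_eq_iff)
    have "z \<in> S" using z by (auto simp: S_def span_base orthogonal_commute)
    have "f x = f z" using assms p by (simp add: x linear_add)
    then have "norm (x - p) \<le> 1 / e * norm (f x)"
      using e[OF \<open>z \<in> S\<close>] \<open>e > 0\<close> by (simp add: x field_simps)
    then show "\<exists>p. f p = 0 \<and> norm (x - p) \<le> 1 / e * norm (f x)" using p by blast
  qed (use \<open>e > 0\<close> in simp)
qed

text \<open>\<open>T\<close> stands for \<open>D\<close> minus the (2,2) perturbation, and
  \<open>f\<close>, \<open>h\<close>, \<open>h'\<close> for the other deviations from the
  unperturbed system. The order of the quantifiers matters: \<theta> and \<open>K\<close> are fixed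
  before \<mu>, \<open>M\<close>, \<open>T\<close> and all vectors. The term \<open>f\<close> is
  only required to be small relative to \<open>w\<close>, not of order \<mu>, because the (1,1)
  perturbation contains a multiple of \<open>u / \<mu>\<close>.\<close>

lemma saddle_point_estimate:
  fixes A :: "'y::euclidean_space \<Rightarrow> 'w::euclidean_space" and B :: "'w \<Rightarrow> 'y"
    and m0 c CM CT :: real
  assumes A: "linear A" and B: "linear B" and adj: "\<And>x y. x \<bullet> A y = B x \<bullet> y"
    and "m0 > 0" "c > 0"
  obtains \<theta> K where "\<theta> > 0" "K > 0"
    "\<And>\<mu> M T w y f h h' r1 r3 r4.
      0 < \<mu> \<Longrightarrow> \<mu> \<le> \<theta> \<Longrightarrow>
      linear M \<Longrightarrow> (\<And>x. norm (M x) \<le> CM * norm x) \<Longrightarrow>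
      (\<And>p. B p = 0 \<Longrightarrow> m0 * (norm p)\<^sup>2 \<le> p \<bullet> M p) \<Longrightarrow>
      linear T \<Longrightarrow> (\<And>q. norm (T q) \<le> CT * \<mu> * norm q) \<Longrightarrow>
      (\<And>q. c * \<mu> * (norm q)\<^sup>2 \<le> q \<bullet> T q) \<Longrightarrow>
      norm f \<le> \<theta> * norm w \<Longrightarrow> norm h \<le> CT * \<mu> * norm y \<Longrightarrow> norm h' \<le> CT * \<mu> * norm w \<Longrightarrow>
      M w + f + (A y + h) = r1 \<Longrightarrow> B (w - r3) + h' = T y + r4 \<Longrightarrow>
      norm w \<le> K * (norm r1 + norm r3 + norm r4) \<and>
      norm (A y) \<le> K * (norm r1 + norm r3 + norm r4) \<and>
      norm y \<le> K * (norm r1 + norm r3 + norm r4 / \<mu>)"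
proof -
  obtain k1 where "k1 > 0" and k1: "\<And>x. \<exists>p. A p = 0 \<and> norm (x - p) \<le> k1 * norm (A x)"
    using kernel_distance_bound[OF A] by blast
  obtain k2 where "k2 > 0" and k2: "\<And>x. \<exists>p. B p = 0 \<and> norm (x - p) \<le> k2 * norm (B x)"
    using kernel_distance_bound[OF B] by blast
  \<comment> \<open>A single constant dominating all given ones and the needed reciprocals, so that
    the later bounds are polynomials in \<open>C\<close>.\<close>
  define C where "C = 1 + \<bar>CM\<bar> + \<bar>CT\<bar> + 1 / m0 + 1 / c + k1 + k2"
  have C: "1 \<le> C" "CM \<le> C" "CT \<le> C" "1 / m0 \<le> C" "1 / c \<le> C" "k1 \<le> C" "k2 \<le> C"
    using \<open>m0 > 0\<close> \<open>c > 0\<close> \<open>k1 > 0\<close> \<open>k2 > 0\<close> by (auto simp: C_def add_increasing add_increasing2)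
  have C0: "0 \<le> C" using C by simp
  \<comment> \<open>One constant per stage below: \<open>C1\<close> bounds
    \<open>\<mu> * norm y\<close>, \<open>C2\<close> bounds \<open>A y\<close>, \<open>C3\<close>
    bounds \<open>\<mu> * norm y\<close> once \<open>A y\<close> is eliminated, \<open>C4\<close>
    and \<open>C5\<close> bound the distances of \<open>w - r3\<close> and \<open>w\<close> to a
    null vector of \<open>B\<close>, \<open>C6\<close> bounds the residual tested by coercivity, and
    \<open>C7\<close> bounds \<open>w\<close>.\<close>
  define C1 where "C1 = C * (C + 1 + C * C) + C"
  define C2 where "C2 = 2 * (2 + C + C * C1)"
  define C3 where "C3 = C1 * (1 + C2 + C2 + 1)"
  define C4 where "C4 = C * (C * C3 + 1 + C)"
  define C5 where "C5 = C4 + 1"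
  define C6 where "C6 = 1 + 1 + C * C3 + C * C5"
  define C7 where "C7 = C * C6 + C5"
  \<comment> \<open>Small enough to absorb, at the cost of a factor 2, the terms in
    \<open>A y\<close> and \<open>w\<close> that reappear on the right of their own bounds.\<close>
  define \<theta> where "\<theta> = 1 / (2 * (1 + C * C1 + C7))"
  define K where "K = 1 + 2 * C7 + C2 * (2 * C7 + 1) + C1 * (2 * C7 + C2 * (2 * C7 + 1) + 1)"
  have pos: "0 \<le> C1" "0 \<le> C2" "0 \<le> C3" "0 \<le> C4" "0 \<le> C5" "0 \<le> C6" "0 \<le> C7"
    using C0 by (auto simp: C1_def C2_def C3_def C4_def C5_def C6_def C7_def)
  have D: "1 + C * C1 + C7 > 0" using pos C0 by (simp add: add_pos_nonneg)
  have \<theta>: "\<theta> > 0" "C * C1 * \<theta> \<le> 1/2" "C7 * \<theta> \<le> 1/2" "\<theta> \<le> 1"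
    using D pos C0 by (auto simp: \<theta>_def field_simps)
  have "K > 0" using pos by (auto simp: K_def intro!: add_pos_nonneg)
  show ?thesis
  proof (rule that[OF \<theta>(1) \<open>K > 0\<close>])
    fix \<mu> :: real and M :: "'w \<Rightarrow> 'w" and T :: "'y \<Rightarrow> 'y" and w y f h h' r1 r3 r4
    assume "0 < \<mu>" "\<mu> \<le> \<theta>" and linM: "linear M" and nM': "\<And>x. norm (M x) \<le> CM * norm x"
      and coM: "\<And>p. B p = 0 \<Longrightarrow> m0 * (norm p)\<^sup>2 \<le> p \<bullet> M p"
      and linT: "linear T" and nT': "\<And>q. norm (T q) \<le> CT * \<mu> * norm q"
      and coT: "\<And>q. c * \<mu> * (norm q)\<^sup>2 \<le> q \<bullet> T q"
      and f: "norm f \<le> \<theta> * norm w" and h': "norm h \<le> CT * \<mu> * norm y"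
      and h'': "norm h' \<le> CT * \<mu> * norm w"
      and eq1: "M w + f + (A y + h) = r1" and eq2: "B (w - r3) + h' = T y + r4"
    define R where "R = norm r1 + norm r3 + norm r4"
    have R: "norm r1 \<le> R" "norm r3 \<le> R" "norm r4 \<le> R" "0 \<le> R" by (auto simp: R_def)
    have \<mu>1: "\<mu> \<le> 1" using \<open>\<mu> \<le> \<theta>\<close> \<theta> by simp
    have nM: "norm (M x) \<le> C * norm x" for x
      using nM' C(2) by (meson mult_right_mono norm_ge_zero order_trans)
    have CT\<mu>: "CT * \<mu> * norm x \<le> C * \<mu> * norm x" for x :: "'b::real_normed_vector"
      using C(3) \<open>0 < \<mu>\<close> by (simp add: mult_right_mono)
    have nT: "norm (T q) \<le> C * (\<mu> * norm q)" for q
      using nT' CT\<mu>[of q] by (metis mult.assoc order_trans)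
    have h: "norm h \<le> C * (\<mu> * norm y)" using h' CT\<mu>[of y] by (simp add: mult.assoc)
    have h': "norm h' \<le> C * (\<mu> * norm w)" using h'' CT\<mu>[of w] by (simp add: mult.assoc)

    \<comment> \<open>The vector \<open>y\<close> scaled by \<mu>\<close>
    obtain q where q: "A q = 0" "norm (y - q) \<le> C * norm (A y)"
      using k1[of y] C(6) by (meson mult_right_mono norm_ge_zero order_trans)
    define S where "S = \<mu> * norm w + \<mu> * norm (A y) + norm r4"
    have S: "\<mu> * norm w \<le> S" "\<mu> * norm (A y) \<le> S" "norm r4 \<le> S"
      using \<open>0 < \<mu>\<close> by (auto simp: S_def)
    have \<mu>yq: "\<mu> * norm (y - q) \<le> C * (\<mu> * norm (A y))"
      using mult_left_mono[OF q(2), of \<mu>] \<open>0 < \<mu>\<close> by (simp add: ac_simps)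
    have \<mu>q: "\<mu> * norm q \<le> C * ((C + 1 + C * C) * S)"
    proof (cases "q = 0")
      case True
      then show ?thesis using C0 S(1) \<open>0 < \<mu>\<close>
        by (simp add: S_def)
    next
      case False
      \<comment> \<open>As \<open>A q = 0\<close>, adjointness removes the only term of the second
        equation that is not small, and coercivity of \<open>T\<close> bounds
        \<open>q\<close>.\<close>
      have "q \<bullet> B (w - r3) = 0"
        using adj[of "w - r3" q] q(1) by (simp add: inner_commute)
      moreover have "T q = B (w - r3) + h' - r4 - T (y - q)"
        using eq2 linT by (simp add: linear_diff algebra_simps)
      ultimately have "q \<bullet> T q = q \<bullet> (h' - r4 - T (y - q))"
        by (simp add: inner_diff_right inner_add_right)
      also have "\<dots> \<le> norm q * norm (h' - r4 - T (y - q))" by (rule norm_cauchy_schwarz)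
      finally have qT: "q \<bullet> T q \<le> norm q * norm (h' - r4 - T (y - q))" .
      have "norm (h' - r4 - T (y - q)) \<le> norm h' + norm r4 + norm (T (y - q))"
        using norm_triangle_ineq4[of "h' - r4" "T (y - q)"] norm_triangle_ineq4[of h' r4] by linarith
      also have "\<dots> \<le> C * (\<mu> * norm w) + norm r4 + C * (C * (\<mu> * norm (A y)))"
        using h' order_trans[OF nT mult_left_mono[OF \<mu>yq C0]] by (intro add_mono) auto
      also have "\<dots> \<le> C * S + S + C * (C * S)"
        using S C0 by (intro add_mono mult_left_mono) auto
      finally have "norm (h' - r4 - T (y - q)) \<le> (C + 1 + C * C) * S"
        by (simp add: algebra_simps)
      then have "q \<bullet> T q \<le> norm q * ((C + 1 + C * C) * S)"
        using qT by (meson mult_left_mono norm_ge_zero order_trans)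
      then have "c * \<mu> * (norm q)\<^sup>2 \<le> norm q * ((C + 1 + C * C) * S)"
        using coT by (meson order_trans)
      then have "norm q * (c * \<mu> * norm q) \<le> norm q * ((C + 1 + C * C) * S)"
        by (simp add: power2_eq_square ac_simps)
      then have "c * (\<mu> * norm q) \<le> (C + 1 + C * C) * S"
        using False by (simp add: mult.assoc)
      then have "\<mu> * norm q \<le> (1 / c) * ((C + 1 + C * C) * S)"
        using \<open>c > 0\<close> by (simp add: field_simps)
      also have "\<dots> \<le> C * ((C + 1 + C * C) * S)"
        using C(5) C0 S \<open>0 < \<mu>\<close> by (intro mult_right_mono) (auto simp: S_def)
      finally show ?thesis .
    qed
    have \<mu>y: "\<mu> * norm y \<le> C1 * S"
    proof -
      have "\<mu> * norm y \<le> \<mu> * norm q + \<mu> * norm (y - q)"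
        using norm_triangle_ineq[of q "y - q"] \<open>0 < \<mu>\<close> by (simp add: distrib_left[symmetric])
      also have "\<dots> \<le> C * ((C + 1 + C * C) * S) + C * S"
        using \<mu>q order_trans[OF \<mu>yq mult_left_mono[OF S(2) C0]] by (rule add_mono)
      finally show ?thesis by (simp add: C1_def algebra_simps)
    qed

    \<comment> \<open>The image \<open>A y\<close>\<close>
    have Ay: "norm (A y) \<le> C2 * (norm w + R)"
    proof -
      have "A y = r1 - M w - f - h" using eq1 by (simp add: algebra_simps)
      then have "norm (A y) \<le> norm r1 + norm (M w) + norm f + norm h"
        using norm_triangle_ineq4[of "r1 - M w - f" h] norm_triangle_ineq4[of "r1 - M w" f]
          norm_triangle_ineq4[of r1 "M w"] by simp
      also have "\<dots> \<le> R + C * norm w + norm w + C * (C1 * S)"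
      proof (intro add_mono)
        show "norm f \<le> norm w"
          using f mult_right_mono[OF \<theta>(4) norm_ge_zero[of w]] by simp
        show "norm h \<le> C * (C1 * S)"
          using h mult_left_mono[OF \<mu>y C0] by simp
      qed (use R nM in auto)
      also have "C * (C1 * S) = C * C1 * (norm w * \<mu>) + C * C1 * norm r4 + (C * C1 * \<mu>) * norm (A y)"
        by (simp add: S_def algebra_simps)
      \<comment> \<open>The bound on \<open>h\<close> brings \<open>A y\<close> back, but with the
        factor \<open>C * C1 * \<mu>\<close>, at most 1/2, so it can be moved to the left.\<close>
      also have "R + C * norm w + norm w + \<dots>
          \<le> R + C * norm w + norm w + (C * C1 * norm w + C * C1 * R + 1/2 * norm (A y))"
      proof (intro add_mono order_refl mult_right_mono mult_left_mono)
        show "C * C1 * \<mu> \<le> 1/2"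
          using \<theta>(2) mult_left_mono[OF \<open>\<mu> \<le> \<theta>\<close>, of "C * C1"] C0 pos(1) by simp
        show "norm w * \<mu> \<le> norm w" using \<mu>1 by (simp add: mult_left_le)
      qed (use C0 pos R in auto)
      finally have "norm (A y) \<le> 2 * (R + C * norm w + norm w + (C * C1 * norm w + C * C1 * R))"
        by simp
      also have "\<dots> \<le> C2 * (norm w + R)"
        using R C0 by (simp add: C2_def algebra_simps)
      finally show ?thesis .
    qed
    \<comment> \<open>In \<open>S\<close> the term \<open>A y\<close> carries a factor \<mu>.
      Eliminating it therefore leaves \<open>w\<close> weighted by \<mu>, which makes the distance
      of \<open>w\<close> to the null space of \<open>B\<close> small relative to \<open>w\<close>,
      up to the data \<open>R\<close>.\<close>
    define V where "V = \<mu> * norm w + R"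
    have V: "\<mu> * norm w \<le> V" "R \<le> V" "0 \<le> V"
      using R \<open>0 < \<mu>\<close> by (auto simp: V_def)
    have "S \<le> (1 + C2 + C2 + 1) * V"
    proof -
      have "\<mu> * norm (A y) \<le> C2 * (\<mu> * norm w) + C2 * (\<mu> * R)"
        using mult_left_mono[OF Ay, of \<mu>] \<open>0 < \<mu>\<close> by (simp add: algebra_simps)
      also have "\<dots> \<le> C2 * V + C2 * V"
        using V \<mu>1 R \<open>0 < \<mu>\<close> pos
        by (intro add_mono mult_left_mono) (auto intro: order_trans[OF mult_left_le_one_le])
      finally show ?thesis using V R by (simp add: S_def algebra_simps)
    qed
    then have \<mu>yV: "\<mu> * norm y \<le> C3 * V"
      using \<mu>y mult_left_mono[of S "(1 + C2 + C2 + 1) * V" C1] pos by (simp add: C3_def mult.assoc)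

    \<comment> \<open>Distance to the null space of \<open>B\<close>, and coercivity there\<close>
    obtain p where p: "B p = 0" and "norm (w - r3 - p) \<le> C * norm (B (w - r3))"
      using k2[of "w - r3"] C(7) by (meson mult_right_mono norm_ge_zero order_trans)
    have "norm (w - r3 - p) \<le> C4 * V"
    proof -
      have "B (w - r3) = T y + r4 - h'" using eq2 by (simp add: algebra_simps)
      then have "norm (B (w - r3)) \<le> norm (T y) + norm r4 + norm h'"
        using norm_triangle_ineq4[of "T y + r4" h'] norm_triangle_ineq[of "T y" r4]
        by simp
      also have "\<dots> \<le> C * (C3 * V) + V + C * V"
        using order_trans[OF nT mult_left_mono[OF \<mu>yV C0]] R V C0
          order_trans[OF h' mult_left_mono[OF V(1) C0]]
        by (intro add_mono) auto
      finally have "C * norm (B (w - r3)) \<le> C * (C * (C3 * V) + V + C * V)"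
        using C0 by (rule mult_left_mono)
      then show ?thesis
        using \<open>norm (w - r3 - p) \<le> C * norm (B (w - r3))\<close>
        by (simp add: C4_def algebra_simps)
    qed
    then have wp: "norm (w - p) \<le> C5 * V"
      using norm_triangle_ineq[of "w - r3 - p" r3] R V by (simp add: C5_def algebra_simps)
    \<comment> \<open>The weight of \<open>w\<close> rises from \<mu> to \<theta> because the first
      equation also contains \<open>f\<close>.\<close>
    define Z where "Z = \<theta> * norm w + R"
    have Z: "V \<le> Z" "\<theta> * norm w \<le> Z" "R \<le> Z" "0 \<le> Z"
      using R \<theta> \<open>\<mu> \<le> \<theta>\<close> by (auto simp: Z_def V_def mult_right_mono)
    have np: "norm p \<le> C * (C6 * Z)"
    proof (cases "p = 0")
      case True
      then show ?thesis using C0 pos Z by simp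
    next
      case False
      \<comment> \<open>Testing with a null vector of \<open>B\<close> removes \<open>A y\<close>;
        then \<open>y\<close> enters only through \<open>h\<close>, which carries a factor
        \<mu>.\<close>
      have "p \<bullet> A y = 0" using adj[of p y] p by simp
      moreover have "M p = r1 - f - h - A y - M (w - p)"
        using eq1 linM by (simp add: linear_diff algebra_simps)
      ultimately have "p \<bullet> M p = p \<bullet> (r1 - f - h - M (w - p))"
        by (simp add: inner_diff_right)
      also have "\<dots> \<le> norm p * norm (r1 - f - h - M (w - p))" by (rule norm_cauchy_schwarz)
      finally have pM: "p \<bullet> M p \<le> norm p * norm (r1 - f - h - M (w - p))" .
      have "norm (r1 - f - h - M (w - p)) \<le> norm r1 + norm f + norm h + norm (M (w - p))"
        using norm_triangle_ineq4[of "r1 - f - h" "M (w - p)"] norm_triangle_ineq4[of "r1 - f" h]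
          norm_triangle_ineq4[of r1 f] by linarith
      also have "\<dots> \<le> Z + Z + C * (C3 * Z) + C * (C5 * Z)"
      proof (intro add_mono)
        show "norm h \<le> C * (C3 * Z)"
          using h mult_left_mono[OF order_trans[OF \<mu>yV mult_left_mono[OF Z(1) pos(3)]] C0] by simp
        show "norm (M (w - p)) \<le> C * (C5 * Z)"
          using nM[of "w - p"] mult_left_mono[OF order_trans[OF wp mult_left_mono[OF Z(1) pos(5)]] C0]
          by simp
      qed (use R Z f in auto)
      finally have "norm (r1 - f - h - M (w - p)) \<le> C6 * Z"
        by (simp add: C6_def algebra_simps)
      then have "p \<bullet> M p \<le> norm p * (C6 * Z)"
        using pM by (meson mult_left_mono norm_ge_zero order_trans)
      then have "norm p * (m0 * norm p) \<le> norm p * (C6 * Z)"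
        using coM[OF p] by (simp add: power2_eq_square ac_simps)
      then have "norm p \<le> (1 / m0) * (C6 * Z)"
        using False \<open>m0 > 0\<close> by (simp add: field_simps)
      also have "\<dots> \<le> C * (C6 * Z)"
        using C(4) pos Z by (intro mult_right_mono) auto
      finally show ?thesis .
    qed
    have "norm w \<le> norm p + norm (w - p)"
      using norm_triangle_ineq[of p "w - p"] by simp
    also have "\<dots> \<le> C * (C6 * Z) + C5 * Z"
      using np wp mult_left_mono[OF Z(1) pos(5)] by linarith
    also have "\<dots> = (C7 * \<theta>) * norm w + C7 * R"
      by (simp add: C7_def Z_def algebra_simps)
    \<comment> \<open>The second absorption: \<open>C7 * \<theta>\<close> is at most 1/2.\<close>
    also have "\<dots> \<le> 1/2 * norm w + C7 * R"
      using \<theta>(3) R pos by (intro add_mono mult_right_mono) auto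
    finally have w: "norm w \<le> 2 * C7 * R" by simp
    have Ay': "norm (A y) \<le> C2 * (2 * C7 + 1) * R"
      using Ay mult_left_mono[of "norm w + R" "2 * C7 * R + R" C2] w pos
      by (simp add: algebra_simps)
    have y: "norm y \<le> C1 * (2 * C7 + C2 * (2 * C7 + 1) + 1) * (norm r1 + norm r3 + norm r4 / \<mu>)"
    proof -
      define R' where "R' = norm r1 + norm r3 + norm r4 / \<mu>"
      have r4: "norm r4 \<le> norm r4 / \<mu>"
        using \<mu>1 \<open>0 < \<mu>\<close> by (simp add: field_simps mult_left_le_one_le)
      then have "R \<le> R'" by (simp add: R_def R'_def)
      \<comment> \<open>All of \<open>S\<close> except \<open>r4\<close> carries a factor \<mu>, so
        recovering \<open>y\<close> from \<open>\<mu> * norm y\<close> costs a division by \<mu> in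
        \<open>r4\<close> only.\<close>
      have "S = \<mu> * (norm w + norm (A y) + norm r4 / \<mu>)"
        using \<open>0 < \<mu>\<close> by (simp add: S_def field_simps)
      then have "\<mu> * norm y \<le> \<mu> * (C1 * (norm w + norm (A y) + norm r4 / \<mu>))"
        using \<mu>y by (simp add: ac_simps)
      then have "norm y \<le> C1 * (norm w + norm (A y) + norm r4 / \<mu>)"
        using \<open>0 < \<mu>\<close> by simp
      also have "\<dots> \<le> C1 * (2 * C7 * R' + C2 * (2 * C7 + 1) * R' + R')"
      proof (intro mult_left_mono add_mono)
        show "norm w \<le> 2 * C7 * R'"
          using w mult_left_mono[OF \<open>R \<le> R'\<close>, of "2 * C7"] pos by simp
        show "norm (A y) \<le> C2 * (2 * C7 + 1) * R'"
          using Ay' mult_left_mono[OF \<open>R \<le> R'\<close>, of "C2 * (2 * C7 + 1)"] pos by simp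
        show "norm r4 / \<mu> \<le> R'" by (simp add: R'_def)
      qed (use pos in auto)
      finally show ?thesis by (simp add: R'_def algebra_simps)
    qed
    have "2 * C7 \<le> K" "C2 * (2 * C7 + 1) \<le> K"
      "C1 * (2 * C7 + C2 * (2 * C7 + 1) + 1) \<le> K"
      using pos by (auto simp: K_def add_increasing add_increasing2)
    moreover have "0 \<le> norm r1 + norm r3 + norm r4 / \<mu>" using \<open>0 < \<mu>\<close> by simp
    ultimately show "norm w \<le> K * (norm r1 + norm r3 + norm r4) \<and>
      norm (A y) \<le> K * (norm r1 + norm r3 + norm r4) \<and>
      norm y \<le> K * (norm r1 + norm r3 + norm r4 / \<mu>)"
      using w Ay' y R(4) unfolding R_def[symmetric]
      by (meson mult_right_mono order_trans)
  qed
qed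

section \<open>Matrices indexed by finite sets and singular values\<close>

text \<open>Padding by zero embeds vectors and matrices over varying index sets into fixed Euclidean
  spaces, preserving norms and products, so that constants can be chosen for linear maps between
  fixed spaces.\<close>

definition vec_on :: "'i set \<Rightarrow> ('i \<Rightarrow> real) \<Rightarrow> real^'i" where
  "vec_on I x = (\<chi> i. if i \<in> I then x i else 0)"

definition mat_on :: "'i set \<Rightarrow> 'j set \<Rightarrow> ('i \<Rightarrow> 'j \<Rightarrow> real) \<Rightarrow> real^'j^'i" where
  "mat_on I J E = (\<chi> i j. if i \<in> I \<and> j \<in> J then E i j else 0)"

lemma norm_vec_on: "norm (vec_on I x) = L2_set x I"
proof -
  have "(\<Sum>i\<in>UNIV. (norm (vec_on I x $ i))\<^sup>2) = (\<Sum>i\<in>UNIV. if i \<in> I then (x i)\<^sup>2 else 0)"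
    by (rule sum.cong) (auto simp: vec_on_def)
  then show ?thesis by (simp add: norm_vec_def L2_set_def sum.If_cases)
qed

lemma norm_mat_on: "norm (mat_on I J E) = fro_norm I J E"
proof -
  have "(norm (mat_on I J E))\<^sup>2 = (\<Sum>i\<in>UNIV. (norm (mat_on I J E $ i))\<^sup>2)"
    by (simp add: norm_vec_def L2_set_def sum_nonneg)
  also have "\<dots> = (\<Sum>i\<in>UNIV. if i \<in> I then (\<Sum>j\<in>J. (E i j)\<^sup>2) else 0)"
  proof (rule sum.cong)
    fix i
    have "mat_on I J E $ i = (if i \<in> I then vec_on J (E i) else 0)"
      by (simp add: mat_on_def vec_on_def vec_eq_iff)
    then show "(norm (mat_on I J E $ i))\<^sup>2 = (if i \<in> I then (\<Sum>j\<in>J. (E i j)\<^sup>2) else 0)"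
      by (simp add: norm_vec_on L2_set_def sum_nonneg)
  qed simp
  also have "\<dots> = (\<Sum>(i, j)\<in>I \<times> J. (E i j)\<^sup>2)"
    by (simp add: sum.If_cases sum.cartesian_product)
  also have "\<dots> = (fro_norm I J E)\<^sup>2"
    by (simp add: fro_norm_def L2_set_def sum_nonneg split_def)
  finally show ?thesis
    by (simp add: fro_norm_def)
qed

lemma mat_on_mult_vec_on: "mat_on I J E *v vec_on J x = vec_on I (mulv J E x)"
proof (rule vec_eq_iff[THEN iffD2], rule allI)
  fix i
  have "(mat_on I J E *v vec_on J x) $ i = (\<Sum>j\<in>UNIV. if j \<in> J then (if i \<in> I then E i j * x j else 0) else 0)"
    unfolding matrix_vector_mult_def by (auto simp: mat_on_def vec_on_def intro!: sum.cong)
  then show "(mat_on I J E *v vec_on J x) $ i = vec_on I (mulv J E x) $ i"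
    by (simp add: vec_on_def mulv_def sum.If_cases)
qed

lemma transpose_mat_on: "transpose (mat_on I J E) = mat_on J I (\<lambda>j i. E i j)"
  by (auto simp: transpose_def mat_on_def vec_eq_iff)

lemma vec_on_UNIV_nth [simp]: "vec_on UNIV (($) x) = x"
  by (simp add: vec_on_def vec_eq_iff)

lemma norm_matrix_vector_mult_le:
  fixes A :: "real^'n^'m"
  shows "norm (A *v x) \<le> norm A * norm x"
proof -
  have "norm (A *v x) = L2_set (\<lambda>i. \<bar>A $ i \<bullet> x\<bar>) UNIV"
    by (simp add: norm_vec_def matrix_mult_dot)
  also have "\<dots> \<le> L2_set (\<lambda>i. norm (A $ i) * norm x) UNIV"
    by (intro L2_set_mono Cauchy_Schwarz_ineq2) auto
  also have "\<dots> = norm A * norm x"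
    by (simp add: norm_vec_def[of A] L2_set_left_distrib)
  finally show ?thesis .
qed

section \<open>Orthogonal bases and singular vectors\<close>

lemma orthogonal_on_expansion:
  assumes "orthogonal_on I L P" "finite I" "i \<in> I"
  shows "(\<Sum>k\<in>L. P i k * tmulv I P x k) = x i"
proof -
  have "(\<Sum>k\<in>L. P i k * tmulv I P x k) = (\<Sum>j\<in>I. (\<Sum>k\<in>L. P i k * P j k) * x j)"
    unfolding tmulv_def sum_distrib_left sum_distrib_right
    by (subst sum.swap) (simp add: mult.assoc)
  also have "\<dots> = (\<Sum>j\<in>I. if i = j then x j else 0)"
    using assms by (intro sum.cong) (auto simp: orthogonal_on_def)
  finally show ?thesis using assms by simp
qed

text \<open>Enlarging \<open>K\<close> to the complete system \<open>L\<close> gives Parseval's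
  identity.\<close>

lemma Bessel_orthogonal_on:
  assumes "orthogonal_on I L P" "K \<subseteq> L" "finite L" "finite I"
  shows "L2_set (tmulv I P x) K \<le> L2_set x I"
proof -
  have "(\<Sum>k\<in>K. (tmulv I P x k)\<^sup>2) \<le> (\<Sum>k\<in>L. (tmulv I P x k)\<^sup>2)"
    using assms by (intro sum_mono2) auto
  also have "\<dots> = (\<Sum>k\<in>L. (\<Sum>i\<in>I. P i k * x i) * tmulv I P x k)"
    by (simp add: tmulv_def power2_eq_square)
  also have "\<dots> = (\<Sum>i\<in>I. x i * (\<Sum>k\<in>L. P i k * tmulv I P x k))"
    unfolding sum_distrib_left sum_distrib_right by (subst sum.swap) (simp add: ac_simps)
  also have "\<dots> = (\<Sum>i\<in>I. (x i)\<^sup>2)"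
    using assms by (simp add: orthogonal_on_expansion power2_eq_square)
  finally show ?thesis by (simp add: L2_set_def)
qed

lemma svd_mult_right_singular:
  assumes "is_svd I J A r sig P Q" "k < r" "i \<in> I"
  shows "(\<Sum>j\<in>J. A i j * Q j k) = P i k * sig k"
proof -
  have "r \<le> card J" and orth: "orthogonal_on J {..<card J} Q"
    and A: "\<And>j. j \<in> J \<Longrightarrow> A i j = (\<Sum>l<r. P i l * sig l * Q j l)"
    using assms by (auto simp: is_svd_def)
  have "(\<Sum>j\<in>J. A i j * Q j k) = (\<Sum>j\<in>J. \<Sum>l<r. P i l * sig l * Q j l * Q j k)"
    by (simp add: A sum_distrib_right)
  also have "\<dots> = (\<Sum>l<r. P i l * sig l * (\<Sum>j\<in>J. Q j l * Q j k))"
    by (subst sum.swap) (simp add: sum_distrib_left mult.assoc)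
  also have "\<dots> = (\<Sum>l<r. if l = k then P i l * sig l else 0)"
    using orth \<open>r \<le> card J\<close> \<open>k < r\<close> by (intro sum.cong) (auto simp: orthogonal_on_def)
  also have "\<dots> = P i k * sig k" using \<open>k < r\<close> by simp
  finally show ?thesis .
qed

lemma svd_transpose: "is_svd I J A r sig P Q \<Longrightarrow> is_svd J I (\<lambda>j i. A i j) r sig Q P"
  by (auto simp: is_svd_def intro!: sum.cong)

text \<open>Testing \<open>A x = 0\<close> with the \<open>k\<close>-th left singular vector gives
  \<open>sig k\<close> times the component of \<open>x\<close> along the \<open>k\<close>-th right
  one, and \<open>sig k\<close> is positive.\<close>

lemma svd_right_null:
  assumes svd: "is_svd I J A r sig P Q" and "\<And>i. i \<in> I \<Longrightarrow> (\<Sum>j\<in>J. A i j * x j) = 0" "k < r"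
  shows "tmulv J Q x k = 0"
proof -
  have "sig k * (\<Sum>j\<in>J. Q j k * x j) = (\<Sum>j\<in>J. (\<Sum>i\<in>I. A i j * P i k) * x j)"
    using svd_mult_right_singular[OF svd_transpose[OF svd] \<open>k < r\<close>]
    by (simp add: sum_distrib_left ac_simps)
  also have "\<dots> = (\<Sum>i\<in>I. P i k * (\<Sum>j\<in>J. A i j * x j))"
    unfolding sum_distrib_right sum_distrib_left by (subst sum.swap) (simp add: ac_simps)
  also have "\<dots> = 0" using assms by simp
  finally show ?thesis using svd \<open>k < r\<close> by (force simp: is_svd_def tmulv_def)
qed

section \<open>Least eigenvalues\<close>

lemma sigma_min_diag_le:
  fixes sig :: "nat \<Rightarrow> real"
  assumes "0 < r"
  shows "sigma_min {..<r} (diag sig) \<le> sig 0"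
proof -
  have mv: "mulv {..<r} (diag sig) v i = sig i * v i" if "i < r" for v i
  proof -
    have "mulv {..<r} (diag sig) v i = (\<Sum>j<r. if i = j then sig i * v i else 0)"
      unfolding mulv_def by (intro sum.cong) (auto simp: diag_def)
    then show ?thesis using that by simp
  qed
  have eq: "is_eigenvalue {..<r} (diag sig) e \<longleftrightarrow> e \<in> sig ` {..<r}" for e
  proof
    assume "is_eigenvalue {..<r} (diag sig) e"
    then show "e \<in> sig ` {..<r}" by (auto simp: is_eigenvalue_def mv)
  next
    assume "e \<in> sig ` {..<r}"
    then obtain k where "k < r" "e = sig k" by auto
    then show "is_eigenvalue {..<r} (diag sig) e"
      unfolding is_eigenvalue_def by (intro exI[of _ "\<lambda>i. if i = k then 1 else 0"]) (auto simp: mv)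
  qed
  \<comment> \<open>The eigenvalues form a finite nonempty set, so the \<open>LEAST\<close> in
    \<open>sigma_min\<close> is attained.\<close>
  have "sigma_min {..<r} (diag sig) = Min (sig ` {..<r})"
    unfolding sigma_min_def eq using assms by (subst Least_Min) auto
  also have "\<dots> \<le> sig 0" using assms by (intro Min_le) auto
  finally show ?thesis .
qed

text \<open>\<open>A\<close> maps the first right singular vector, of norm 1, to
  \<open>sig 0\<close> times a unit vector.\<close>

lemma svd_singular_value_le:
  fixes A :: "'i::finite \<Rightarrow> 'j::finite \<Rightarrow> real"
  assumes svd: "is_svd I J A r sig P Q" and "0 < r"
  shows "sig 0 \<le> fro_norm I J A"
proof -
  have unit: "L2_set (\<lambda>i. P i 0) I = 1" "L2_set (\<lambda>j. Q j 0) J = 1"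
    using assms by (auto simp: is_svd_def orthogonal_on_def L2_set_def power2_eq_square)
  have "vec_on I (mulv J A (\<lambda>j. Q j 0)) = sig 0 *\<^sub>R vec_on I (\<lambda>i. P i 0)"
    using svd_mult_right_singular[OF svd \<open>0 < r\<close>] by (simp add: vec_on_def vec_eq_iff mulv_def)
  then have "\<bar>sig 0\<bar> = norm (mat_on I J A *v vec_on J (\<lambda>j. Q j 0))"
    by (simp add: mat_on_mult_vec_on norm_vec_on unit)
  also have "\<dots> \<le> fro_norm I J A"
    using norm_matrix_vector_mult_le[of "mat_on I J A" "vec_on J (\<lambda>j. Q j 0)"]
    by (simp add: norm_mat_on norm_vec_on unit)
  finally show ?thesis by simp
qed

text \<open>A minimizer of the Rayleigh quotient of \<open>M\<close> on the span of the columns \<open>{r..}\<close> of \<open>P\<close> is an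
  eigenvector of the compression; since every eigenvalue of the compression is a value of that
  quotient, the least eigenvalue is its minimum.\<close>
lemma sigma_min_congruence_le:
  fixes M :: "real^'n^'n"
  assumes sym: "\<And>u v. u \<bullet> (M *v v) = v \<bullet> (M *v u)"
    and orth: "orthogonal_on UNIV {..<CARD('n)} P" and "r < CARD('n)"
    and x: "\<And>k. k < r \<Longrightarrow> tmulv UNIV P (($) x) k = 0"
  shows "sigma_min {r..<CARD('n)} (congruence UNIV (\<lambda>i j. M $ i $ j) P) * (norm x)\<^sup>2 \<le> x \<bullet> (M *v x)"
proof -
  define n where "n = CARD('n)"
  define c :: "nat \<Rightarrow> real^'n" where "c k = (\<chi> i. P i k)" for k
  \<comment> \<open>The span of the columns from \<open>r\<close> on, described as the orthogonal
    complement of the first \<open>r\<close>; \<open>comb\<close> builds its elements from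
    coordinates.\<close>
  define W where "W = {x. \<forall>k<r. c k \<bullet> x = 0}"
  define comb where "comb v = (\<Sum>k\<in>{r..<n}. v k *\<^sub>R c k)" for v
  let ?C = "congruence UNIV (\<lambda>i j. M $ i $ j) P"
  have cc: "c k \<bullet> c l = (if k = l then 1 else 0)" if "k < n" "l < n" for k l
    using orth that by (simp add: c_def inner_vec_def orthogonal_on_def n_def)
  have tm: "tmulv UNIV P (($) x) k = c k \<bullet> x" for x k
    by (simp add: tmulv_def c_def inner_vec_def)
  have "x \<in> W" using x by (simp add: W_def tm)
  have sW: "subspace W"
    by (auto simp: W_def subspace_def inner_add_right)
  have complete: "x = (\<Sum>k<n. (c k \<bullet> x) *\<^sub>R c k)" for x
  proof (rule vec_eq_iff[THEN iffD2], rule allI)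
    fix i
    show "x $ i = (\<Sum>k<n. (c k \<bullet> x) *\<^sub>R c k) $ i"
      using orthogonal_on_expansion[OF orth, of i "($) x"] by (simp add: tm n_def c_def ac_simps)
  qed
  have expand: "x = comb (\<lambda>k. c k \<bullet> x)" if "x \<in> W" for x
  proof -
    have "(\<Sum>k<n. (c k \<bullet> x) *\<^sub>R c k) = (\<Sum>k\<in>{r..<n}. (c k \<bullet> x) *\<^sub>R c k)"
      using that by (intro sum.mono_neutral_right) (auto simp: W_def)
    then show ?thesis using complete[of x] by (simp add: comb_def)
  qed
  have c_comb: "c k \<bullet> comb v = (if k \<in> {r..<n} then v k else 0)" if "k < n" for k v
  proof -
    have "c k \<bullet> comb v = (\<Sum>l\<in>{r..<n}. if k = l then v l else 0)"
      unfolding comb_def inner_sum_right using that by (intro sum.cong) (auto simp: cc)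
    then show ?thesis by simp
  qed
  have comb_W: "comb v \<in> W" for v
    using \<open>r < CARD('n)\<close> by (auto simp: W_def c_comb n_def)
  have Cv: "mulv {r..<n} ?C v k = c k \<bullet> (M *v comb v)" for v k
  proof -
    have "?C k l = c k \<bullet> (M *v c l)" for l
      by (simp add: congruence_def c_def inner_vec_def matrix_vector_mult_def sum_distrib_left mult.assoc)
    then show ?thesis
      by (simp add: mulv_def comb_def linear_sum[OF matrix_vector_mul_linear] inner_sum_right
          matrix_vector_mult_scaleR ac_simps)
  qed
  have "compact (W \<inter> sphere 0 1)"
    using sW by (intro closed_Int_compact closed_subspace) auto
  moreover have "c r \<in> W \<inter> sphere 0 1"
    using \<open>r < CARD('n)\<close> by (auto simp: W_def cc n_def norm_eq_sqrt_inner)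
  moreover have "continuous_on (W \<inter> sphere 0 1) (\<lambda>y. y \<bullet> (M *v y))"
    by (intro continuous_intros linear_continuous_on) (simp add: linear_conv_bounded_linear[symmetric])
  ultimately have "\<exists>p\<in>W \<inter> sphere 0 1. \<forall>y\<in>W \<inter> sphere 0 1. p \<bullet> (M *v p) \<le> y \<bullet> (M *v y)"
    by (intro continuous_attains_inf) auto
  then obtain p where p: "p \<in> W" "norm p = 1"
    and min: "\<And>y. y \<in> W \<Longrightarrow> norm y = 1 \<Longrightarrow> p \<bullet> (M *v p) \<le> y \<bullet> (M *v y)"
    by auto
  define m where "m = p \<bullet> (M *v p)"
  have Rayleigh: "m * (norm y)\<^sup>2 \<le> y \<bullet> (M *v y)" if "y \<in> W" for y
  proof (cases "y = 0")
    case False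
    define z where "z = (1 / norm y) *\<^sub>R y"
    have "z \<in> W" "norm z = 1" using that False sW by (auto simp: z_def subspace_scale)
    then have "m \<le> z \<bullet> (M *v z)" unfolding m_def by (rule min)
    also have "\<dots> = (y \<bullet> (M *v y)) / (norm y)\<^sup>2"
      by (simp add: z_def matrix_vector_mult_scaleR power2_eq_square)
    finally show ?thesis using False by (simp add: field_simps)
  qed simp
  have stationary: "h \<bullet> (M *v p) = m * (h \<bullet> p)" if "h \<in> W" for h
  proof -
    \<comment> \<open>Along the line through \<open>p\<close> in direction \<open>h\<close>, the
      function \<open>y \<bullet> (M *v y) - m * (y \<bullet> y)\<close> is nonnegative and vanishes
      at \<open>p\<close>; \<open>2 * b\<close> and \<open>a\<close> are its linear and quadratic
      coefficients.\<close>
    define b where "b = h \<bullet> (M *v p) - m * (h \<bullet> p)"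
    define a where "a = h \<bullet> (M *v h) - m * (h \<bullet> h)"
    have quad: "0 \<le> \<tau> * (2 * b + \<tau> * a)" for \<tau>
    proof -
      have "p + \<tau> *\<^sub>R h \<in> W" using p that sW by (simp add: subspace_add subspace_scale)
      from Rayleigh[OF this] have "0 \<le> (p + \<tau> *\<^sub>R h) \<bullet> (M *v (p + \<tau> *\<^sub>R h)) - m * ((p + \<tau> *\<^sub>R h) \<bullet> (p + \<tau> *\<^sub>R h))"
        by (simp add: power2_norm_eq_inner)
      also have "\<dots> = \<tau> * (2 * b + \<tau> * a) + (p \<bullet> (M *v p) - m * (p \<bullet> p))"
        using sym[of p h]
        by (simp add: a_def b_def matrix_vector_mult_scaleR matrix_vector_right_distrib
            inner_add_left inner_add_right inner_commute algebra_simps)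
      also have "p \<bullet> (M *v p) - m * (p \<bullet> p) = 0"
        using p by (simp add: m_def power2_norm_eq_inner[symmetric])
      finally show ?thesis by simp
    qed
    have "b = 0"
    proof (rule ccontr)
      assume "b \<noteq> 0"
      \<comment> \<open>A step against the sign of \<open>b\<close>, short enough that the quadratic
        contribution cannot outweigh the linear one.\<close>
      define \<tau> where "\<tau> = - b / (1 + \<bar>a\<bar>)"
      have "1 + \<bar>a\<bar> > 0" by simp
      have "b * (2 * b + \<tau> * a) / (1 + \<bar>a\<bar>) \<le> 0"
        using quad[of \<tau>] by (simp add: \<tau>_def)
      then have "b * (2 * b + \<tau> * a) \<le> 0"
        by (simp add: pos_divide_le_eq[OF \<open>1 + \<bar>a\<bar> > 0\<close>])
      moreover have "b * (2 * b + \<tau> * a) = 2 * b\<^sup>2 + \<tau> * a * b" by (simp add: power2_eq_square algebra_simps)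
      moreover have "\<bar>\<tau> * a * b\<bar> \<le> b\<^sup>2"
      proof -
        have "\<bar>\<tau> * a * b\<bar> = \<bar>a\<bar> / (1 + \<bar>a\<bar>) * b\<^sup>2"
          by (simp add: \<tau>_def abs_mult power2_eq_square)
        also have "\<dots> \<le> 1 * b\<^sup>2" by (intro mult_right_mono) (auto simp: field_simps)
        finally show ?thesis by simp
      qed
      ultimately have "b\<^sup>2 \<le> 0" by linarith
      then show False using \<open>b \<noteq> 0\<close> by simp
    qed
    then show ?thesis by (simp add: b_def)
  qed
  have "is_eigenvalue {r..<n} ?C m"
    unfolding is_eigenvalue_def
  proof (intro exI conjI ballI)
    let ?v = "\<lambda>k. c k \<bullet> p"
    have "p \<noteq> 0" using p by auto
    show "\<exists>k\<in>{r..<n}. ?v k \<noteq> 0"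
    proof (rule ccontr)
      assume "\<not> ?thesis"
      then have "comb ?v = 0" by (simp add: comb_def)
      then show False using expand[OF p(1)] \<open>p \<noteq> 0\<close> by simp
    qed
    fix k assume k: "k \<in> {r..<n}"
    then have "c k \<in> W" using \<open>r < CARD('n)\<close> by (auto simp: W_def cc n_def)
    then show "mulv {r..<n} ?C ?v k = m * ?v k"
      using expand[OF p(1)] stationary by (simp add: Cv)
  qed
  moreover have "m \<le> e" if "is_eigenvalue {r..<n} ?C e" for e
  proof -
    obtain v k where k: "k \<in> {r..<n}" "v k \<noteq> 0"
      and ev: "\<And>k. k \<in> {r..<n} \<Longrightarrow> mulv {r..<n} ?C v k = e * v k"
      using \<open>is_eigenvalue {r..<n} ?C e\<close> unfolding is_eigenvalue_def by blast
    have "comb v \<noteq> 0" using c_comb[of k v] k by auto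
    have "comb v \<bullet> (M *v comb v) = (\<Sum>k\<in>{r..<n}. v k * (e * v k))"
      using ev by (simp add: comb_def[of v] inner_sum_left) (simp add: comb_def[symmetric] Cv)
    also have "\<dots> = e * (comb v \<bullet> comb v)"
    proof -
      have "comb v \<bullet> comb v = (\<Sum>k\<in>{r..<n}. v k * (c k \<bullet> comb v))"
        by (subst comb_def) (simp add: inner_sum_left)
      also have "\<dots> = (\<Sum>k\<in>{r..<n}. v k * v k)"
        by (intro sum.cong) (auto simp: c_comb)
      finally show ?thesis by (simp add: sum_distrib_left ac_simps)
    qed
    finally have "m * (norm (comb v))\<^sup>2 \<le> e * (norm (comb v))\<^sup>2"
      using Rayleigh[OF comb_W, of v] by (simp add: power2_norm_eq_inner)
    then show ?thesis using \<open>comb v \<noteq> 0\<close> by simp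
  qed
  ultimately have "sigma_min {r..<n} ?C = m"
    unfolding sigma_min_def by (rule Least_equality)
  then show ?thesis using Rayleigh[OF \<open>x \<in> W\<close>] by (simp add: n_def)
qed

section \<open>Derivatives of the Lagrangian and the multiplier set\<close>

lemma grad_eqI:
  fixes f :: "real^'n \<Rightarrow> real"
  assumes "GDERIV f x :> D"
  shows "grad f x = D"
  unfolding grad_def
proof (rule the_equality)
  show "GDERIV f x :> D" by (rule assms)
  fix D' assume "GDERIV f x :> D'"
  then have "(\<lambda>h. h \<bullet> D') = (\<lambda>h. h \<bullet> D)"
    using assms unfolding gderiv_def by (rule has_derivative_unique)
  then show "D' = D" by (metis inner_commute vector_eq_ldot)
qed

lemma GDERIV_grad:
  fixes f :: "real^'n \<Rightarrow> real"
  assumes "f differentiable (at x)"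
  shows "GDERIV f x :> grad f x"
proof -
  obtain f' where f': "(f has_derivative f') (at x)"
    using assms by (auto simp: differentiable_def)
  \<comment> \<open>The Riesz representative of the derivative is its adjoint at 1.\<close>
  have "f' h = h \<bullet> adjoint f' 1" for h
    using adjoint_works[OF has_derivative_linear[OF f'], of h 1] by simp
  then have "f' = (\<lambda>h. h \<bullet> adjoint f' 1)" by blast
  then have "GDERIV f x :> adjoint f' 1"
    using f' unfolding gderiv_def by metis
  then show ?thesis using grad_eqI by metis
qed

lemma grad_has_derivative:
  "grad f differentiable (at x) \<Longrightarrow> (grad f has_derivative (\<lambda>h. hessian f x *v h)) (at x)"
  by (simp add: hessian_def jacobian_works)

lemma hessian_eqI:
  assumes "(grad f has_derivative (\<lambda>h. M *v h)) (at x)"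
  shows "hessian f x = M"
  using frechet_derivative_at[OF assms, symmetric]
  by (simp add: hessian_def jacobian_def matrix_of_matrix_vector_mul)

lemma hessian_symmetric:
  assumes "twice_lipschitz_differentiable f"
  shows "u \<bullet> (hessian f x *v v) = v \<bullet> (hessian f x *v u)"
  using assms unfolding twice_lipschitz_differentiable_def
  by (intro second_derivative_symmetric[of f "grad f" _ x] GDERIV_grad grad_has_derivative) auto

lemma twice_lipschitz_local_bound:
  assumes "twice_lipschitz_differentiable f"
  shows "\<exists>e>0. \<exists>L\<ge>0. \<forall>z. norm (z - x) < e \<longrightarrow>
    norm (grad f z - grad f x) \<le> L * norm (z - x) \<and>
    norm (hessian f z - hessian f x) \<le> L * norm (z - x)"
proof -
  obtain e1 L1 where "e1 > 0" and L1: "L1-lipschitz_on (ball x e1) (hessian f)"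
    using assms unfolding twice_lipschitz_differentiable_def by blast
  have "(grad f has_derivative (\<lambda>h. hessian f x *v h)) (at x)"
    using assms by (auto simp: twice_lipschitz_differentiable_def intro: grad_has_derivative)
  \<comment> \<open>Differentiability with tolerance 1 bounds the increment of the gradient by its
    linear part plus the distance to \<open>x\<close>, hence linearly in that distance.\<close>
  then obtain e2 where "e2 > 0" and e2: "\<And>z. norm (z - x) < e2 \<Longrightarrow>
      norm (grad f z - grad f x - hessian f x *v (z - x)) \<le> 1 * norm (z - x)"
    unfolding has_derivative_at_alt by (metis zero_less_one)
  obtain K where K: "\<And>h. norm (hessian f x *v h) \<le> norm h * K"
    using bounded_linear.bounded[OF matrix_vector_mul_bounded_linear] by blast
  have pos: "min e1 e2 > 0" "1 + \<bar>K\<bar> + L1 \<ge> 0"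
    using \<open>e1 > 0\<close> \<open>e2 > 0\<close> lipschitz_on_nonneg[OF L1] by auto
  show ?thesis
  proof (rule exI[of _ "min e1 e2"], intro conjI pos(1), rule exI[of _ "1 + \<bar>K\<bar> + L1"],
      intro conjI pos(2) allI impI)
    fix z assume z: "norm (z - x) < min e1 e2"
    have L1': "norm (hessian f z - hessian f x) \<le> L1 * norm (z - x)"
      using lipschitz_onD[OF L1, of z x] z \<open>e1 > 0\<close> by (simp add: dist_norm norm_minus_commute)
    show "norm (hessian f z - hessian f x) \<le> (1 + \<bar>K\<bar> + L1) * norm (z - x)"
      using L1' mult_right_mono[of L1 "1 + \<bar>K\<bar> + L1" "norm (z - x)"] by simp
    have "norm (grad f z - grad f x) \<le>
        norm (grad f z - grad f x - hessian f x *v (z - x)) + norm (hessian f x *v (z - x))"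
      using norm_triangle_ineq[of "grad f z - grad f x - hessian f x *v (z - x)" "hessian f x *v (z - x)"]
      by simp
    also have "\<dots> \<le> norm (z - x) + norm (z - x) * K"
      using e2[of z] z K[of "z - x"] by simp
    also have "\<dots> \<le> (1 + \<bar>K\<bar> + L1) * norm (z - x)"
      using mult_right_mono[OF abs_ge_self[of K] norm_ge_zero[of "z - x"]]
        mult_nonneg_nonneg[OF lipschitz_on_nonneg[OF L1] norm_ge_zero[of "z - x"]]
      by (simp add: algebra_simps)
    finally show "norm (grad f z - grad f x) \<le> (1 + \<bar>K\<bar> + L1) * norm (z - x)" .
  qed
qed

lemma twice_lipschitz_local_bound_family:
  fixes F :: "'i::finite \<Rightarrow> real^'n \<Rightarrow> real"
  assumes "\<And>i. twice_lipschitz_differentiable (F i)"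
  shows "\<exists>e>0. \<exists>L\<ge>0. \<forall>z i. norm (z - x) < e \<longrightarrow>
    norm (grad (F i) z - grad (F i) x) \<le> L * norm (z - x) \<and>
    norm (hessian (F i) z - hessian (F i) x) \<le> L * norm (z - x)"
proof -
  have "\<forall>i. \<exists>e L. e > 0 \<and> L \<ge> 0 \<and> (\<forall>z. norm (z - x) < e \<longrightarrow>
    norm (grad (F i) z - grad (F i) x) \<le> L * norm (z - x) \<and>
    norm (hessian (F i) z - hessian (F i) x) \<le> L * norm (z - x))"
    using twice_lipschitz_local_bound[OF assms] by blast
  then obtain e L where e: "\<And>i. e i > 0" and L: "\<And>i. L i \<ge> (0::real)"
    and b: "\<And>i z. norm (z - x) < e i \<Longrightarrow>
      norm (grad (F i) z - grad (F i) x) \<le> L i * norm (z - x) \<and>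
      norm (hessian (F i) z - hessian (F i) x) \<le> L i * norm (z - x)"
    by metis
  have "L i \<le> (\<Sum>i\<in>UNIV. L i)" for i
    using L by (intro member_le_sum) auto
  then have Lb: "L i * norm (z - x) \<le> (\<Sum>i\<in>UNIV. L i) * norm (z - x)" for i z
    by (simp add: mult_right_mono)
  have pos: "Min (range e) > 0" "(\<Sum>i\<in>UNIV. L i) \<ge> 0"
    using e L by (auto simp: Min_gr_iff sum_nonneg)
  show ?thesis
  proof (rule exI[of _ "Min (range e)"], intro conjI pos(1), rule exI[of _ "\<Sum>i\<in>UNIV. L i"],
      intro conjI pos(2) allI impI)
    fix z i assume "norm (z - x) < Min (range e)"
    then have "norm (z - x) < e i" by (simp add: Min_gr_iff)
    from b[OF this] show "norm (grad (F i) z - grad (F i) x) \<le> (\<Sum>i\<in>UNIV. L i) * norm (z - x)"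
      "norm (hessian (F i) z - hessian (F i) x) \<le> (\<Sum>i\<in>UNIV. L i) * norm (z - x)"
      using Lb[of i z] by linarith+
  qed
qed

section \<open>Derivatives of the Lagrangian\<close>

lemma sum_scaleR_matrix_vector_mult:
  fixes M :: "'i \<Rightarrow> real^'n^'m"
  shows "(\<Sum>i\<in>I. a i *\<^sub>R M i) *v x = (\<Sum>i\<in>I. a i *\<^sub>R (M i *v x))"
  by (induction I rule: infinite_finite_induct)
    (auto simp: matrix_vector_mult_add_rdistrib scaleR_matrix_vector_assoc)

lemma grad_lagrangian:
  assumes "\<phi> differentiable (at x)" and "\<And>i. (\<lambda>x. g x $ i) differentiable (at x)"
  shows "grad (\<lambda>x. lagrangian \<phi> g x lam) x =
    grad \<phi> x + (\<Sum>i\<in>UNIV. lam $ i *\<^sub>R grad (\<lambda>x. g x $ i) x)"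
proof (rule grad_eqI)
  have lag: "lagrangian \<phi> g x lam = \<phi> x + (\<Sum>i\<in>UNIV. lam $ i * g x $ i)" for x
    by (simp add: lagrangian_def inner_vec_def)
  have "((\<lambda>x. lam $ i * g x $ i) has_derivative (\<lambda>h. lam $ i * (h \<bullet> grad (\<lambda>x. g x $ i) x))) (at x)" for i
    using GDERIV_grad[OF assms(2)[of i]] unfolding gderiv_def by (rule has_derivative_mult_right)
  then have "((\<lambda>x. \<phi> x + (\<Sum>i\<in>UNIV. lam $ i * g x $ i)) has_derivative
      (\<lambda>h. h \<bullet> grad \<phi> x + (\<Sum>i\<in>UNIV. lam $ i * (h \<bullet> grad (\<lambda>x. g x $ i) x)))) (at x)"
    using GDERIV_grad[OF assms(1)] unfolding gderiv_def
    by (intro has_derivative_add has_derivative_sum)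
  then show "GDERIV (\<lambda>x. lagrangian \<phi> g x lam) x :>
      grad \<phi> x + (\<Sum>i\<in>UNIV. lam $ i *\<^sub>R grad (\<lambda>x. g x $ i) x)"
    using lag by (simp add: gderiv_def inner_add_right inner_sum_right)
qed

text \<open>Makes the Hessian explicit as an affine function of the multiplier, so that its size,
  symmetry and variation reduce to those of the constituent Hessians.\<close>

lemma lagrangian_zz_eq:
  assumes "twice_lipschitz_differentiable \<phi>"
    and "\<And>i. twice_lipschitz_differentiable (\<lambda>x. g x $ i)"
  shows "lagrangian_zz \<phi> g z lam =
    hessian \<phi> z + (\<Sum>i\<in>UNIV. lam $ i *\<^sub>R hessian (\<lambda>x. g x $ i) z)"
  unfolding lagrangian_zz_def
proof (rule hessian_eqI)
  have d: "f differentiable (at x)" "(grad f has_derivative (\<lambda>h. hessian f x *v h)) (at x)"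
    if "twice_lipschitz_differentiable f" for f and x :: "real^'a"
    using that by (auto simp: twice_lipschitz_differentiable_def intro: grad_has_derivative)
  have "grad (\<lambda>x. lagrangian \<phi> g x lam) =
      (\<lambda>x. grad \<phi> x + (\<Sum>i\<in>UNIV. lam $ i *\<^sub>R grad (\<lambda>x. g x $ i) x))"
    by (intro ext grad_lagrangian d assms)
  moreover have "(\<dots> has_derivative (\<lambda>h. hessian \<phi> z *v h +
      (\<Sum>i\<in>UNIV. lam $ i *\<^sub>R (hessian (\<lambda>x. g x $ i) z *v h)))) (at z)"
    by (intro has_derivative_add has_derivative_sum has_derivative_scaleR_right d assms)
  moreover have "(\<Sum>i\<in>UNIV. lam $ i *\<^sub>R (hessian (\<lambda>x. g x $ i) z *v h)) =
      (\<Sum>i\<in>UNIV. lam $ i *\<^sub>R hessian (\<lambda>x. g x $ i) z) *v h" for h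
    by (rule sum_scaleR_matrix_vector_mult[symmetric])
  ultimately show "(grad (\<lambda>x. lagrangian \<phi> g x lam) has_derivative
      (\<lambda>h. (hessian \<phi> z + (\<Sum>i\<in>UNIV. lam $ i *\<^sub>R hessian (\<lambda>x. g x $ i) z)) *v h)) (at z)"
    by (simp add: matrix_vector_mult_add_rdistrib)
qed

lemma lagrangian_zz_symmetric:
  assumes "twice_lipschitz_differentiable \<phi>"
    and "\<And>i. twice_lipschitz_differentiable (\<lambda>x. g x $ i)"
  shows "u \<bullet> (lagrangian_zz \<phi> g z lam *v v) = v \<bullet> (lagrangian_zz \<phi> g z lam *v u)"
proof -
  have key: "u \<bullet> (lagrangian_zz \<phi> g z lam *v v) = u \<bullet> (hessian \<phi> z *v v) +
      (\<Sum>i\<in>UNIV. lam $ i * (u \<bullet> (hessian (\<lambda>x. g x $ i) z *v v)))" for u v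
  proof -
    have "(\<Sum>i\<in>UNIV. lam $ i *\<^sub>R hessian (\<lambda>x. g x $ i) z) *v v =
        (\<Sum>i\<in>UNIV. lam $ i *\<^sub>R (hessian (\<lambda>x. g x $ i) z *v v))"
      by (rule sum_scaleR_matrix_vector_mult)
    then show ?thesis
      by (simp add: lagrangian_zz_eq[OF assms] matrix_vector_mult_add_rdistrib
          inner_add_right inner_sum_right)
  qed
  have "u \<bullet> (hessian \<phi> z *v v) = v \<bullet> (hessian \<phi> z *v u)"
    "\<And>i. u \<bullet> (hessian (\<lambda>x. g x $ i) z *v v) = v \<bullet> (hessian (\<lambda>x. g x $ i) z *v u)"
    by (rule hessian_symmetric, rule assms)+
  then show ?thesis by (simp add: key)
qed

text \<open>Testing stationarity of the Lagrangian against the direction supplied by MFCQ.\<close>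
lemma multipliers_bounded:
  assumes "\<phi> differentiable (at zs)" and "\<And>i. (\<lambda>x. g x $ i) differentiable (at zs)"
    and "MFCQ g zs"
  shows "\<exists>C. \<forall>lam\<in>multipliers \<phi> g zs. norm lam \<le> C"
proof -
  obtain d where d: "\<And>i. i \<in> active g zs \<Longrightarrow> grad (\<lambda>x. g x $ i) zs \<bullet> d < 0"
    using assms(3) by (auto simp: MFCQ_def)
  define a where "a i = - (grad (\<lambda>x. g x $ i) zs \<bullet> d)" for i
  define b where "b = grad \<phi> zs \<bullet> d"
  \<comment> \<open>For inactive \<open>i\<close> the summand may be a division by zero, with value
    0; this is harmless, as the multiplier component vanishes there.\<close>
  have "norm lam \<le> (\<Sum>i\<in>UNIV. \<bar>b / a i\<bar>)" if "lam \<in> multipliers \<phi> g zs" for lam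
  proof -
    have stat: "grad \<phi> zs + (\<Sum>i\<in>UNIV. lam $ i *\<^sub>R grad (\<lambda>x. g x $ i) zs) = 0"
      and g: "\<And>i. g zs $ i \<le> 0" and lam: "\<And>i. lam $ i \<ge> 0" and compl: "lam \<bullet> g zs = 0"
      using that grad_lagrangian[OF assms(1,2), of lam] by (auto simp: multipliers_def KKT_def)
    \<comment> \<open>Complementarity: nonnegative terms with sum zero all vanish.\<close>
    have "(\<Sum>i\<in>UNIV. - (lam $ i * g zs $ i)) = 0"
      using compl by (simp add: inner_vec_def sum_negf)
    then have "- (lam $ i * g zs $ i) = 0" for i
      using g lam by (subst (asm) sum_nonneg_eq_0_iff) (auto simp: mult_le_0_iff)
    then have inactive: "lam $ i = 0" if "i \<notin> active g zs" for i
      using that by (auto simp: active_def)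
    have nonneg: "lam $ i * a i \<ge> 0" for i
      using lam[of i] d[of i] inactive[of i] by (cases "i \<in> active g zs") (auto simp: a_def mult_le_0_iff)
    have "b + (\<Sum>i\<in>UNIV. lam $ i * (grad (\<lambda>x. g x $ i) zs \<bullet> d)) = 0"
      using arg_cong[OF stat, of "\<lambda>v. v \<bullet> d"] by (simp add: b_def inner_add_left inner_sum_left)
    then have "(\<Sum>i\<in>UNIV. lam $ i * a i) = b"
      by (simp add: a_def sum_negf)
    then have le: "lam $ i * a i \<le> b" for i
      using member_le_sum[of i UNIV "\<lambda>i. lam $ i * a i"] nonneg by simp
    have "\<bar>lam $ i\<bar> \<le> \<bar>b / a i\<bar>" for i
    proof (cases "i \<in> active g zs")
      case True
      then have "a i > 0" using d by (simp add: a_def)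
      then show ?thesis using le[of i] lam[of i] nonneg[of i] by (simp add: field_simps abs_if)
    qed (simp add: inactive)
    then have "(\<Sum>i\<in>UNIV. \<bar>lam $ i\<bar>) \<le> (\<Sum>i\<in>UNIV. \<bar>b / a i\<bar>)" by (intro sum_mono)
    then show ?thesis using norm_le_l1_cart[of lam] by linarith
  qed
  then show ?thesis by blast
qed

section \<open>The perturbed system\<close>

lemma norm_matrix_le_entries:
  fixes A :: "real^'n^'m" and a :: real
  assumes "\<And>i j. \<bar>A $ i $ j\<bar> \<le> a"
  shows "norm A \<le> CARD('m) * (CARD('n) * a)"
proof -
  have row: "norm (A $ i) \<le> CARD('n) * a" for i
    using norm_le_l1_cart[of "A $ i"] sum_bounded_above[of UNIV "\<lambda>j. \<bar>A $ i $ j\<bar>" a] assms by force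
  have "norm A \<le> (\<Sum>i\<in>UNIV. norm (A $ i))"
    unfolding norm_vec_def by (rule L2_set_le_sum) auto
  also have "\<dots> \<le> CARD('m) * (CARD('n) * a)"
    using sum_bounded_above[of UNIV "\<lambda>i. norm (A $ i)" "CARD('n) * a"] row by force
  finally show ?thesis .
qed

text \<open>A strict bound on an infimum is met by some member of the set, and the projections of
  the product are nonexpansive.\<close>

lemma sol_dist_nearby_multiplier:
  assumes "multipliers \<phi> g zs \<noteq> {}" "sol_dist \<phi> g zs z lam < d"
  shows "\<exists>lams\<in>multipliers \<phi> g zs. norm (z - zs) \<le> d \<and> norm (lam - lams) \<le> d"
proof -
  have "(INF a\<in>{zs} \<times> multipliers \<phi> g zs. dist (z, lam) a) < d"
    using assms by (simp add: sol_dist_def infdist_def)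
  then obtain lams where "lams \<in> multipliers \<phi> g zs" "dist (z, lam) (zs, lams) < d"
    using assms(1) by (subst (asm) cINF_less_iff) (auto intro!: bdd_belowI2[of _ 0])
  then show ?thesis
    using dist_fst_le[of "(z, lam)" "(zs, lams)"] dist_snd_le[of "(z, lam)" "(zs, lams)"]
    by (intro bexI[of _ lams]) (auto simp: dist_norm)
qed

lemma abs_grad_mat_le: "\<bar>grad_mat g z j i\<bar> \<le> norm (grad (\<lambda>x. g x $ i) z)"
  by (simp add: grad_mat_def component_le_norm_cart)

text \<open>Uniformity in the multiplier comes from MFCQ, which bounds the multiplier set.\<close>
lemma nlp_data_perturbation:
  fixes \<phi> :: "real^'n \<Rightarrow> real" and g :: "real^'n \<Rightarrow> real^'m"
  assumes tw\<phi>: "twice_lipschitz_differentiable \<phi>"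
    and twg: "\<And>i. twice_lipschitz_differentiable (\<lambda>x. g x $ i)"
    and "MFCQ g zs" and \<kappa>: "0 \<le> \<kappa>" and C: "0 \<le> C"
  obtains \<mu>0 L where "\<mu>0 > 0" "L > 0"
    "\<And>\<mu> z lam lams d. 0 < \<mu> \<Longrightarrow> \<mu> \<le> \<mu>0 \<Longrightarrow>
      lams \<in> multipliers \<phi> g zs \<Longrightarrow> norm (z - zs) \<le> \<kappa> * \<mu> \<Longrightarrow> norm (lam - lams) \<le> \<kappa> * \<mu> \<Longrightarrow>
      (\<And>i. i \<in> N \<Longrightarrow> 0 \<le> d i \<and> d i \<le> C * \<mu>) \<Longrightarrow>
      norm (lagrangian_zz \<phi> g zs lams) \<le> L \<and>
      norm (lagrangian_zz \<phi> g z lam - lagrangian_zz \<phi> g zs lams) \<le> L * \<mu> \<and>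
      norm (mat_on UNIV B (grad_mat g z) - mat_on UNIV B (grad_mat g zs)) \<le> L * \<mu> \<and>
      norm (mat_on UNIV UNIV (\<lambda>j k. \<Sum>i\<in>N. grad_mat g z j i * d i * grad_mat g z k i)) \<le> L * \<mu>"
proof -
  let ?h\<phi> = "hessian \<phi>" and ?hg = "\<lambda>i. hessian (\<lambda>x. g x $ i)" and ?gg = "\<lambda>i. grad (\<lambda>x. g x $ i)"
  have "\<phi> differentiable (at zs)" "\<And>i. (\<lambda>x. g x $ i) differentiable (at zs)"
    using tw\<phi> twg by (auto simp: twice_lipschitz_differentiable_def)
  then obtain \<Lambda> where \<Lambda>: "\<And>lam. lam \<in> multipliers \<phi> g zs \<Longrightarrow> norm lam \<le> \<Lambda>"
    using multipliers_bounded[OF _ _ \<open>MFCQ g zs\<close>, of \<phi>] by blast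
  obtain e1 L1 where "e1 > 0" "L1 \<ge> 0"
    and L1: "\<And>z. norm (z - zs) < e1 \<Longrightarrow> norm (?h\<phi> z - ?h\<phi> zs) \<le> L1 * norm (z - zs)"
    using twice_lipschitz_local_bound[OF tw\<phi>, of zs] by blast
  obtain e2 L2 where "e2 > 0" "L2 \<ge> 0"
    and L2: "\<And>z i. norm (z - zs) < e2 \<Longrightarrow> norm (?gg i z - ?gg i zs) \<le> L2 * norm (z - zs)"
      "\<And>z i. norm (z - zs) < e2 \<Longrightarrow> norm (?hg i z - ?hg i zs) \<le> L2 * norm (z - zs)"
    using twice_lipschitz_local_bound_family[of "\<lambda>i x. g x $ i" zs, OF twg] by blast
  \<comment> \<open>Keeps \<open>\<kappa> * \<mu>\<close> within half of both radii, and \<mu> at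
    most 1 so that squares of \<mu> are of order \<mu>.\<close>
  define \<mu>0 where "\<mu>0 = min 1 (min e1 e2 / (2 * (1 + \<kappa>)))"
  \<comment> \<open>\<Gamma> bounds the entries of all constraint gradients near the solution;
    \<open>a1\<close> to \<open>a4\<close> are the constants of the four conclusions in
    turn.\<close>
  define \<Gamma> where "\<Gamma> = (\<Sum>i\<in>UNIV. norm (?gg i zs)) + L2 * \<kappa>"
  define a1 where "a1 = norm (?h\<phi> zs) + (\<Sum>i\<in>UNIV. \<bar>\<Lambda>\<bar> * norm (?hg i zs))"
  define a2 where "a2 = L1 * \<kappa> + (\<Sum>i\<in>UNIV. (\<bar>\<Lambda>\<bar> + \<kappa>) * (L2 * \<kappa>) + \<kappa> * norm (?hg i zs))"
  define a3 where "a3 = CARD('n) * (CARD('m) * (L2 * \<kappa>))"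
  define a4 where "a4 = CARD('n) * (CARD('n) * (card N * (\<Gamma> * C * \<Gamma>)))"
  have \<Gamma>: "\<Gamma> \<ge> 0" using \<open>L2 \<ge> 0\<close> \<kappa> by (auto simp: \<Gamma>_def intro!: add_nonneg_nonneg sum_nonneg)
  have nonneg: "a1 \<ge> 0" "a2 \<ge> 0" "a3 \<ge> 0" "a4 \<ge> 0"
    using \<open>L1 \<ge> 0\<close> \<open>L2 \<ge> 0\<close> \<kappa> \<Gamma> C
    by (auto simp: a1_def a2_def a3_def a4_def intro!: add_nonneg_nonneg sum_nonneg)
  define L where "L = 1 + a1 + a2 + a3 + a4"
  have L: "L > 0" "a1 \<le> L" "a2 \<le> L" "a3 \<le> L" "a4 \<le> L" using nonneg by (auto simp: L_def)
  have "\<mu>0 > 0" using \<open>e1 > 0\<close> \<open>e2 > 0\<close> \<kappa> by (auto simp: \<mu>0_def)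
  show ?thesis
  proof (rule that[OF \<open>\<mu>0 > 0\<close> \<open>L > 0\<close>])
    fix \<mu> :: real and z lam lams and d :: "'m \<Rightarrow> real"
    assume \<mu>: "0 < \<mu>" "\<mu> \<le> \<mu>0" and lams: "lams \<in> multipliers \<phi> g zs"
      and z: "norm (z - zs) \<le> \<kappa> * \<mu>" and lam: "norm (lam - lams) \<le> \<kappa> * \<mu>"
      and d: "\<And>i. i \<in> N \<Longrightarrow> 0 \<le> d i \<and> d i \<le> C * \<mu>"
    have "\<mu> \<le> 1" using \<mu> by (simp add: \<mu>0_def)
    then have "\<kappa> * \<mu> \<le> \<kappa>" using \<kappa> by (simp add: mult_left_le)
    have "norm (z - zs) < min e1 e2"
    proof -
      have "\<kappa> * \<mu> \<le> (1 + \<kappa>) * \<mu>0"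
        using \<mu> \<kappa> by (intro mult_mono) auto
      also have "\<dots> \<le> (1 + \<kappa>) * (min e1 e2 / (2 * (1 + \<kappa>)))"
        using \<kappa> by (intro mult_left_mono) (auto simp: \<mu>0_def)
      also have "\<dots> = min e1 e2 / 2" using \<kappa> by (simp add: field_simps)
      also have "\<dots> < min e1 e2"
      proof -
        have "0 < min e1 e2" using \<open>e1 > 0\<close> \<open>e2 > 0\<close> by simp
        then show ?thesis by linarith
      qed
      finally show ?thesis using z by simp
    qed
    then have z1: "norm (?h\<phi> z - ?h\<phi> zs) \<le> L1 * (\<kappa> * \<mu>)"
      and z2: "norm (?gg i z - ?gg i zs) \<le> L2 * (\<kappa> * \<mu>)"
      and z3: "norm (?hg i z - ?hg i zs) \<le> L2 * (\<kappa> * \<mu>)" for i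
      using L1[of z] L2[of z i] mult_left_mono[OF z \<open>L1 \<ge> 0\<close>] mult_left_mono[OF z \<open>L2 \<ge> 0\<close>] by auto
    have lams_i: "\<bar>lams $ i\<bar> \<le> \<bar>\<Lambda>\<bar>" for i
      using component_le_norm_cart[of lams i] \<Lambda>[OF lams] by linarith
    have diff_i: "\<bar>lam $ i - lams $ i\<bar> \<le> \<kappa> * \<mu>" for i
      using component_le_norm_cart[of "lam - lams" i] lam by simp
    have lam_i: "\<bar>lam $ i\<bar> \<le> \<bar>\<Lambda>\<bar> + \<kappa>" for i
      using lams_i[of i] diff_i[of i] \<open>\<kappa> * \<mu> \<le> \<kappa>\<close> by linarith
    note zz = lagrangian_zz_eq[OF tw\<phi> twg]
    have "norm (lagrangian_zz \<phi> g zs lams) \<le> norm (?h\<phi> zs) + (\<Sum>i\<in>UNIV. norm (lams $ i *\<^sub>R ?hg i zs))"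
      unfolding zz using norm_triangle_ineq[of "?h\<phi> zs" "\<Sum>i\<in>UNIV. lams $ i *\<^sub>R ?hg i zs"]
        norm_sum[of "\<lambda>i. lams $ i *\<^sub>R ?hg i zs" UNIV] by linarith
    also have "\<dots> \<le> a1"
      unfolding a1_def using lams_i by (auto intro!: add_mono sum_mono mult_right_mono)
    finally have b1: "norm (lagrangian_zz \<phi> g zs lams) \<le> L" using L by simp
    \<comment> \<open>The product difference is split into a change of the point at multiplier
      \<open>lam\<close> and a change of the multiplier at \<open>zs\<close>.\<close>
    have "lagrangian_zz \<phi> g z lam - lagrangian_zz \<phi> g zs lams = (?h\<phi> z - ?h\<phi> zs) +
        (\<Sum>i\<in>UNIV. lam $ i *\<^sub>R (?hg i z - ?hg i zs) + (lam $ i - lams $ i) *\<^sub>R ?hg i zs)"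
      unfolding zz by (simp add: sum.distrib sum_subtractf algebra_simps)
    also have "norm \<dots> \<le> norm (?h\<phi> z - ?h\<phi> zs) +
        (\<Sum>i\<in>UNIV. norm (lam $ i *\<^sub>R (?hg i z - ?hg i zs)) + norm ((lam $ i - lams $ i) *\<^sub>R ?hg i zs))"
      by (rule order_trans[OF norm_triangle_ineq add_left_mono[OF sum_norm_le]]) (rule norm_triangle_ineq)
    also have "\<dots> \<le> L1 * (\<kappa> * \<mu>) +
        (\<Sum>i\<in>UNIV. (\<bar>\<Lambda>\<bar> + \<kappa>) * (L2 * (\<kappa> * \<mu>)) + (\<kappa> * \<mu>) * norm (?hg i zs))"
      unfolding norm_scaleR using z1 z3 lam_i diff_i \<kappa> \<mu>(1)
      by (intro add_mono sum_mono mult_mono order_refl) auto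
    also have "\<dots> = a2 * \<mu>"
      unfolding a2_def distrib_right sum_distrib_right by (simp add: mult_ac)
    also have "\<dots> \<le> L * \<mu>" using L \<mu> by (intro mult_right_mono) auto
    finally have b2: "norm (lagrangian_zz \<phi> g z lam - lagrangian_zz \<phi> g zs lams) \<le> L * \<mu>" .
    have gm_diff: "\<bar>grad_mat g z j i - grad_mat g zs j i\<bar> \<le> L2 * (\<kappa> * \<mu>)" for i j
      using component_le_norm_cart[of "?gg i z - ?gg i zs" j] z2[of i] by (simp add: grad_mat_def)
    have nn: "0 \<le> L2 * (\<kappa> * \<mu>)" using \<open>L2 \<ge> 0\<close> \<kappa> \<mu> by simp
    have "norm (mat_on UNIV B (grad_mat g z) - mat_on UNIV B (grad_mat g zs))
        \<le> CARD('n) * (CARD('m) * (L2 * (\<kappa> * \<mu>)))"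
    proof (intro norm_matrix_le_entries)
      fix j i
      show "\<bar>(mat_on UNIV B (grad_mat g z) - mat_on UNIV B (grad_mat g zs)) $ j $ i\<bar> \<le> L2 * (\<kappa> * \<mu>)"
        using gm_diff[of j i] nn by (cases "i \<in> B") (simp_all add: mat_on_def)
    qed
    also have "\<dots> = a3 * \<mu>" by (simp add: a3_def)
    also have "\<dots> \<le> L * \<mu>" using L \<mu> by (intro mult_right_mono) auto
    finally have b3: "norm (mat_on UNIV B (grad_mat g z) - mat_on UNIV B (grad_mat g zs)) \<le> L * \<mu>" .
    have gm: "\<bar>grad_mat g z j i\<bar> \<le> \<Gamma>" for i j
    proof -
      have "\<bar>grad_mat g z j i\<bar> \<le> norm (?gg i zs) + norm (?gg i z - ?gg i zs)"
        using abs_grad_mat_le[of g z j i] norm_triangle_sub[of "?gg i z" "?gg i zs"] by linarith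
      also have "\<dots> \<le> (\<Sum>i\<in>UNIV. norm (?gg i zs)) + L2 * \<kappa>"
        using z2[of i] mult_left_mono[OF \<open>\<kappa> * \<mu> \<le> \<kappa>\<close> \<open>L2 \<ge> 0\<close>]
        by (intro add_mono member_le_sum) auto
      finally show ?thesis by (simp add: \<Gamma>_def)
    qed
    have "\<bar>\<Sum>i\<in>N. grad_mat g z j i * d i * grad_mat g z k i\<bar> \<le> card N * (\<Gamma> * (C * \<mu>) * \<Gamma>)" for j k
    proof -
      have "\<bar>\<Sum>i\<in>N. grad_mat g z j i * d i * grad_mat g z k i\<bar>
          \<le> (\<Sum>i\<in>N. \<bar>grad_mat g z j i\<bar> * \<bar>d i\<bar> * \<bar>grad_mat g z k i\<bar>)"
        by (rule order_trans[OF sum_abs]) (simp add: abs_mult)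
      also have "\<dots> \<le> (\<Sum>i\<in>N. \<Gamma> * (C * \<mu>) * \<Gamma>)"
        using gm d \<Gamma> C \<mu> by (intro sum_mono mult_mono) auto
      finally show ?thesis by simp
    qed
    then have "norm (mat_on UNIV UNIV (\<lambda>j k. \<Sum>i\<in>N. grad_mat g z j i * d i * grad_mat g z k i))
        \<le> CARD('n) * (CARD('n) * (card N * (\<Gamma> * (C * \<mu>) * \<Gamma>)))"
      by - (rule norm_matrix_le_entries, simp add: mat_on_def)
    also have "\<dots> = a4 * \<mu>" by (simp add: a4_def)
    also have "\<dots> \<le> L * \<mu>" using L \<mu> by (intro mult_right_mono) auto
    finally show "norm (lagrangian_zz \<phi> g zs lams) \<le> L \<and>
      norm (lagrangian_zz \<phi> g z lam - lagrangian_zz \<phi> g zs lams) \<le> L * \<mu> \<and>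
      norm (mat_on UNIV B (grad_mat g z) - mat_on UNIV B (grad_mat g zs)) \<le> L * \<mu> \<and>
      norm (mat_on UNIV UNIV (\<lambda>j k. \<Sum>i\<in>N. grad_mat g z j i * d i * grad_mat g z k i)) \<le> L * \<mu>"
      using b1 b2 b3 by blast
  qed
qed

lemma mulv_add: "mulv J (\<lambda>i j. A i j + E i j) x i = mulv J A x i + mulv J E x i"
  by (simp add: mulv_def algebra_simps sum.distrib)

lemma mat_on_mult: "mat_on I UNIV E *v x = vec_on I (mulv UNIV E (($) x))"
  using mat_on_mult_vec_on[of I UNIV E "($) x"] by simp

text \<open>With padding by zero, the rows of the second block outside \<open>B\<close> read 0 = 0,
  so the index-set system becomes two equations between vectors of fixed dimension.\<close>

lemma perturbed_system_vector_form:
  fixes \<phi> :: "real^'n \<Rightarrow> real" and g :: "real^'n \<Rightarrow> real^'m"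
  assumes "perturbed_system \<phi> g zs z lam s E11 E12 E21 E22 r1 r3 r4 w y"
    and B: "B = active g zs"
  shows "(lagrangian_zz \<phi> g z lam +
        mat_on UNIV UNIV (\<lambda>j k. \<Sum>i\<in>-B. grad_mat g z j i * inverse (D_entry lam s i) * grad_mat g z k i) +
        mat_on UNIV UNIV E11) *v w
      + (mat_on UNIV B (grad_mat g z) + mat_on UNIV B E12) *v vec_on B y = r1" (is ?first)
    and "(transpose (mat_on UNIV B (grad_mat g z)) + mat_on B UNIV E21) *v w
      - vec_on B (\<lambda>i. D_entry lam s i * y i) + mat_on B B E22 *v vec_on B y
      = transpose (mat_on UNIV B (grad_mat g zs)) *v r3 + vec_on B r4" (is ?second)
proof -
  have row1: "mulv UNIV (\<lambda>j k. H_mat \<phi> g zs z lam s j k + E11 j k) (($) w) j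
            + mulv B (\<lambda>j i. grad_mat g z j i + E12 j i) y j = r1 $ j" for j
    using assms by (auto simp: perturbed_system_def Let_def)
  have row2: "i \<in> B \<Longrightarrow> mulv UNIV (\<lambda>i j. grad_mat g z j i + E21 i j) (($) w) i
            + mulv B (\<lambda>i k. - diag (D_entry lam s) i k + E22 i k) y i
          = tmulv UNIV (grad_mat g zs) (($) r3) i + r4 i" for i
    using assms by (auto simp: perturbed_system_def Let_def)
  have zz: "lagrangian_zz \<phi> g z lam *v w = vec_on UNIV (mulv UNIV (\<lambda>j k. lagrangian_zz \<phi> g z lam $ j $ k) (($) w))"
    by (simp add: vec_on_def mulv_def matrix_vector_mult_def vec_eq_iff)
  show ?first
  proof (rule vec_eq_iff[THEN iffD2], rule allI)
    fix j
    show "((lagrangian_zz \<phi> g z lam +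
        mat_on UNIV UNIV (\<lambda>j k. \<Sum>i\<in>-B. grad_mat g z j i * inverse (D_entry lam s i) * grad_mat g z k i) +
        mat_on UNIV UNIV E11) *v w
      + (mat_on UNIV B (grad_mat g z) + mat_on UNIV B E12) *v vec_on B y) $ j = r1 $ j"
      using row1[of j]
      by (simp add: matrix_vector_mult_add_rdistrib zz mat_on_mult mat_on_mult_vec_on H_mat_def mulv_add B)
        (simp add: vec_on_def)
  qed
  have diag: "mulv B (\<lambda>i k. - diag d i k + E22 i k) y i = mulv B E22 y i - d i * y i"
    if "i \<in> B" for d i
  proof -
    have "mulv B (\<lambda>i k. - diag d i k) y i = (\<Sum>k\<in>B. if i = k then - (d i * y i) else 0)"
      unfolding mulv_def diag_def by (intro sum.cong) auto
    then have "mulv B (\<lambda>i k. - diag d i k) y i = - (d i * y i)" using that by simp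
    then show ?thesis using mulv_add[of B "\<lambda>i k. - diag d i k" E22 y i] by linarith
  qed
  show ?second
  proof (rule vec_eq_iff[THEN iffD2], rule allI)
    fix i
    show "((transpose (mat_on UNIV B (grad_mat g z)) + mat_on B UNIV E21) *v w
      - vec_on B (\<lambda>i. D_entry lam s i * y i) + mat_on B B E22 *v vec_on B y) $ i
      = (transpose (mat_on UNIV B (grad_mat g zs)) *v r3 + vec_on B r4) $ i"
      using row2[of i] diag[of i "D_entry lam s"] mulv_add[of UNIV "\<lambda>i j. grad_mat g z j i" E21 "($) w" i]
      by (simp add: transpose_mat_on matrix_vector_mult_add_rdistrib mat_on_mult mat_on_mult_vec_on)
        (auto simp: vec_on_def mulv_def[of UNIV "\<lambda>j i. grad_mat g zs i j"] tmulv_def)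
  qed
qed

text \<open>A vector annihilated by the transpose has no component along the first \<open>r\<close>
  left singular vectors, so it lies in the space on which \<open>sigma_min\<close> bounds the
  Rayleigh quotient. If \<open>r\<close> equals the full dimension, the guarded hypothesis is
  vacuous but the null space is trivial.\<close>

lemma coercive_on_left_null_space:
  fixes M :: "real^'n^'n"
  assumes svd: "is_svd UNIV B A r sig P Q"
    and sym: "\<And>u v. u \<bullet> (M *v v) = v \<bullet> (M *v u)"
    and t: "{r..<CARD('n)} \<noteq> {} \<Longrightarrow>
      t \<le> sigma_min {r..<CARD('n)} (congruence UNIV (\<lambda>i j. M $ i $ j) P)"
    and p: "transpose (mat_on UNIV B A) *v p = 0"
  shows "t * (norm p)\<^sup>2 \<le> p \<bullet> (M *v p)"
proof -
  have orth: "orthogonal_on UNIV {..<CARD('n)} P" and "r \<le> CARD('n)"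
    using svd by (auto simp: is_svd_def)
  have "mulv UNIV (\<lambda>i j. A j i) (($) p) i = 0" if "i \<in> B" for i
    using arg_cong[OF p, of "\<lambda>v. v $ i"] that
    by (simp add: transpose_mat_on mat_on_mult) (simp add: vec_on_def)
  then have null: "tmulv UNIV P (($) p) k = 0" if "k < r" for k
    using svd_right_null[OF svd_transpose[OF svd] _ that, of "($) p"] by (simp add: mulv_def)
  show ?thesis
  proof (cases "r < CARD('n)")
    case True
    have "t * (norm p)\<^sup>2 \<le> sigma_min {r..<CARD('n)} (congruence UNIV (\<lambda>i j. M $ i $ j) P) * (norm p)\<^sup>2"
      using t True by (intro mult_right_mono) auto
    also have "\<dots> \<le> p \<bullet> (M *v p)"
      using sigma_min_congruence_le[OF sym orth True null] .
    finally show ?thesis .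
  next
    case False
    then have "r = CARD('n)" using \<open>r \<le> CARD('n)\<close> by simp
    then have "p $ i = 0" for i
      using orthogonal_on_expansion[OF orth, of i "($) p"] null by simp
    then have "p = 0" by (simp add: vec_eq_iff)
    then show ?thesis by simp
  qed
qed

text \<open>The two spectral conditions are never both vacuous: for positive \<open>r\<close> a
  singular value bounds \<open>t\<close>, and for \<open>r = 0\<close> the first column of
  \<open>P\<close> is an admissible unit vector for the Rayleigh quotient of
  \<open>M\<close>.\<close>

lemma svd_thresholds_bounded:
  fixes M :: "real^'n^'n" and A :: "'n \<Rightarrow> 'm::finite \<Rightarrow> real"
  assumes svd: "is_svd UNIV B A r sig P Q"
    and sym: "\<And>u v. u \<bullet> (M *v v) = v \<bullet> (M *v u)"
    and t1: "{..<r} \<noteq> {} \<Longrightarrow> t \<le> sigma_min {..<r} (diag sig)"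
    and t2: "{r..<CARD('n)} \<noteq> {} \<Longrightarrow>
      t \<le> sigma_min {r..<CARD('n)} (congruence UNIV (\<lambda>i j. M $ i $ j) P)"
  shows "t \<le> fro_norm UNIV B A + norm M"
proof (cases "r = 0")
  case False
  then have "t \<le> fro_norm UNIV B A"
    using t1 sigma_min_diag_le[of r sig] svd_singular_value_le[OF svd] by force
  then show ?thesis using norm_ge_zero[of M] by linarith
next
  case True
  have orth: "orthogonal_on UNIV {..<CARD('n)} P" using svd by (simp add: is_svd_def)
  define p :: "real^'n" where "p = (\<chi> i. P i 0)"
  have "p \<bullet> p = 1"
    using orth by (simp add: p_def inner_vec_def orthogonal_on_def)
  then have "norm p = 1" by (simp add: norm_eq_sqrt_inner)
  have "t \<le> sigma_min {r..<CARD('n)} (congruence UNIV (\<lambda>i j. M $ i $ j) P) * (norm p)\<^sup>2"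
    using t2 True \<open>norm p = 1\<close> by simp
  also have "\<dots> \<le> p \<bullet> (M *v p)"
    using True by (intro sigma_min_congruence_le[OF sym orth]) auto
  also have "\<dots> \<le> norm p * norm (M *v p)" by (rule norm_cauchy_schwarz)
  also have "\<dots> \<le> norm M" using norm_matrix_vector_mult_le[of M p] \<open>norm p = 1\<close> by simp
  finally show ?thesis
    by (simp add: add_increasing fro_norm_def)
qed

text \<open>The constant is chosen before the decomposition, which need not be unique. Subtracting
  from \<open>y\<close> a nearby null vector of the matrix leaves the leading components unchanged,
  and Bessel's inequality bounds what remains.\<close>

lemma row_space_component_bound:
  fixes A :: "'n::finite \<Rightarrow> 'm::finite \<Rightarrow> real"
  shows "\<exists>k>0. \<forall>y r sig P Q. is_svd UNIV B A r sig P Q \<longrightarrow>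
    L2_set (tmulv B Q y) {..<r} \<le> k * norm (mat_on UNIV B A *v vec_on B y)"
proof -
  obtain k where "k > 0" and k: "\<And>x. \<exists>q. mat_on UNIV B A *v q = 0 \<and>
      norm (x - q) \<le> k * norm (mat_on UNIV B A *v x)"
    using kernel_distance_bound[OF matrix_vector_mul_linear, of "mat_on UNIV B A"] by blast
  have "L2_set (tmulv B Q y) {..<r} \<le> k * norm (mat_on UNIV B A *v vec_on B y)"
    if svd: "is_svd UNIV B A r sig P Q" for y r sig P Q
  proof -
    obtain q where q: "mat_on UNIV B A *v q = 0"
      and yq: "norm (vec_on B y - q) \<le> k * norm (mat_on UNIV B A *v vec_on B y)"
      using k by blast
    have "(\<Sum>j\<in>B. A i j * q $ j) = 0" for i
    proof -
      have "(mat_on UNIV B A *v q) $ i = (\<Sum>j\<in>UNIV. if j \<in> B then A i j * q $ j else 0)"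
        unfolding matrix_vector_mult_def by (auto simp: mat_on_def intro!: sum.cong)
      then show ?thesis using q by (simp add: sum.If_cases)
    qed
    then have "tmulv B Q (($) q) l = 0" if "l < r" for l
      using svd_right_null[OF svd _ that] by simp
    then have "tmulv B Q y l = tmulv B Q (\<lambda>j. y j - q $ j) l" if "l < r" for l
      using that by (simp add: tmulv_def algebra_simps sum_subtractf)
    then have "L2_set (tmulv B Q y) {..<r} = L2_set (tmulv B Q (\<lambda>j. y j - q $ j)) {..<r}"
      by (intro L2_set_cong) auto
    also have "\<dots> \<le> L2_set (\<lambda>j. y j - q $ j) B"
      using svd by (intro Bessel_orthogonal_on[where L = "{..<card B}"]) (auto simp: is_svd_def)
    also have "\<dots> = L2_set (\<lambda>j. norm ((vec_on B y - q) $ j)) B"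
      by (auto simp: L2_set_def vec_on_def)
    also have "\<dots> \<le> norm (vec_on B y - q)"
      unfolding norm_vec_def L2_set_def by (intro real_sqrt_le_mono sum_mono2) auto
    finally show ?thesis using yq by simp
  qed
  then show ?thesis using \<open>k > 0\<close> by blast
qed

lemma norm_transpose:
  fixes A :: "real^'n^'m"
  shows "norm (transpose A) = norm A"
proof -
  have "norm (A :: real^'n^'m) = sqrt (\<Sum>i\<in>UNIV. \<Sum>j\<in>UNIV. (A $ i $ j)\<^sup>2)" for A :: "real^'n^'m"
    by (simp add: norm_vec_def L2_set_def sum_nonneg)
  moreover have "norm (A :: real^'m^'n) = sqrt (\<Sum>i\<in>UNIV. \<Sum>j\<in>UNIV. (A $ i $ j)\<^sup>2)" for A :: "real^'m^'n"
    by (simp add: norm_vec_def L2_set_def sum_nonneg)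
  ultimately show ?thesis
    unfolding transpose_def by simp (rule sum.swap)
qed

theorem theorem4p1:
  fixes \<phi> :: "real^'n \<Rightarrow> real"
    and g :: "real^'n \<Rightarrow> real^'m"
    and zs :: "real^'n"
    and C\<delta> cB CB cN CN C11u C11\<mu> C12 C21 C22 :: real
  assumes "twice_lipschitz_differentiable \<phi>"
    and "\<And>i. twice_lipschitz_differentiable (\<lambda>x. g x $ i)"
    and "multipliers \<phi> g zs \<noteq> {}"
    and "MFCQ g zs"
    and "cB > 0" and "cN > 0"
  shows "\<exists>\<beta>0>0. \<exists>\<eta>>0. \<exists>K>0.
    \<forall>(\<beta>::real) (\<mu>::real) (u::real) (z::real^'n) (lam::real^'m) (s::real^'m)
      (E11::'n \<Rightarrow> 'n \<Rightarrow> real) (E12::'n \<Rightarrow> 'm \<Rightarrow> real)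
      (E21::'m \<Rightarrow> 'n \<Rightarrow> real) (E22::'m \<Rightarrow> 'm \<Rightarrow> real)
      (r1::real^'n) (r3::real^'n) (r4::'m \<Rightarrow> real) (w::real^'n) (y::'m \<Rightarrow> real)
      (r::nat) (sig::nat \<Rightarrow> real) (P::'n \<Rightarrow> nat \<Rightarrow> real) (Q::'m \<Rightarrow> nat \<Rightarrow> real).
    let B = active g zs; N = - B; n = CARD('n); b = card B;
        t = \<beta> * max (\<mu> powr (1/3)) (u / \<mu>);
        \<rho> = norm r1 + norm r3
    in
      \<beta> \<ge> \<beta>0 \<longrightarrow> \<mu> > 0 \<longrightarrow> u \<ge> 0 \<longrightarrow> u / \<mu> \<le> \<eta> \<longrightarrow> u \<le> \<eta> \<longrightarrow>
      sol_dist \<phi> g zs z lam \<le> C\<delta> * \<mu> \<longrightarrow>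
      (\<forall>i\<in>B. cB * \<mu> \<le> D_entry lam s i \<and> D_entry lam s i \<le> CB * \<mu>) \<longrightarrow>
      (\<forall>i\<in>N. cN * \<mu> \<le> inverse (D_entry lam s i) \<and> inverse (D_entry lam s i) \<le> CN * \<mu>) \<longrightarrow>
      fro_norm UNIV UNIV E11 \<le> C11u * (u / \<mu>) + C11\<mu> * \<mu> \<longrightarrow>
      fro_norm UNIV B E12 \<le> C12 * u \<longrightarrow>
      fro_norm B UNIV E21 \<le> C21 * u \<longrightarrow>
      fro_norm B B E22 \<le> C22 * u \<longrightarrow>
      perturbed_system \<phi> g zs z lam s E11 E12 E21 E22 r1 r3 r4 w y \<longrightarrow>
      is_svd UNIV B (grad_mat g zs) r sig P Q \<longrightarrow>
      ({..<r} \<noteq> {} \<longrightarrow> sigma_min {..<r} (diag sig) \<ge> t) \<longrightarrow>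
      (\<forall>lams \<in> multipliers \<phi> g zs. {r..<n} \<noteq> {} \<longrightarrow>
         sigma_min {r..<n}
           (congruence UNIV (\<lambda>i j. lagrangian_zz \<phi> g zs lams $ i $ j) P) \<ge> t) \<longrightarrow>
      norm (L2_set (tmulv B Q y) {..<r},
            L2_set (tmulv UNIV P (($) w)) {r..<n},
            L2_set (tmulv UNIV P (($) w)) {..<r})
        \<le> K * (\<rho> + L2_set r4 B) \<and>
      L2_set (tmulv B Q y) {r..<b} \<le> K * (\<rho> + L2_set r4 B / \<mu>)"
proof -

  \<comment> \<open>Constants determined by the problem data\<close>
  let ?B = "active g zs" and ?S = "multipliers \<phi> g zs" and ?M = "lagrangian_zz \<phi> g zs"
  define G where "G = mat_on UNIV ?B (grad_mat g zs)"
  define coercive where "coercive \<tau> \<longleftrightarrow>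
    (\<forall>lams\<in>?S. \<forall>p. transpose G *v p = 0 \<longrightarrow> \<tau> * (norm p)\<^sup>2 \<le> p \<bullet> (?M lams *v p))" for \<tau>
  \<comment> \<open>The spectral hypothesis forces \<open>coercive t\<close> for its threshold \<open>t > 0\<close>. Hence one may fix a
    constant \<open>\<tau>\<close> belonging to the problem data, without compactness of the multiplier set: if no
    positive constant works, the hypotheses are never satisfied.\<close>
  define \<tau> where "\<tau> = (if \<exists>\<tau>>0. coercive \<tau> then SOME \<tau>. \<tau> > 0 \<and> coercive \<tau> else 1)"
  have \<tau>: "\<tau> > 0 \<and> ((\<exists>\<tau>>0. coercive \<tau>) \<longrightarrow> coercive \<tau>)"
    using someI_ex[of "\<lambda>\<tau>. \<tau> > 0 \<and> coercive \<tau>"] by (auto simp: \<tau>_def)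
  have sym: "u \<bullet> (?M lams *v v) = v \<bullet> (?M lams *v u)" for lams u v
    by (rule lagrangian_zz_symmetric[OF assms(1,2)])
  obtain lams0 where lams0: "lams0 \<in> ?S" using assms(3) by blast
  \<comment> \<open>The summand 1 makes the distance bound strict, as needed to select a nearby
    multiplier.\<close>
  define \<kappa> where "\<kappa> = \<bar>C\<delta>\<bar> + 1"
  have "\<kappa> \<ge> 0" by (simp add: \<kappa>_def)
  obtain \<mu>0 L where "\<mu>0 > 0" "L > 0" and pert: "\<And>\<mu> z lam lams d. 0 < \<mu> \<Longrightarrow> \<mu> \<le> \<mu>0 \<Longrightarrow>
    lams \<in> ?S \<Longrightarrow> norm (z - zs) \<le> \<kappa> * \<mu> \<Longrightarrow> norm (lam - lams) \<le> \<kappa> * \<mu> \<Longrightarrow>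
    (\<And>i. i \<in> -?B \<Longrightarrow> 0 \<le> d i \<and> d i \<le> \<bar>CN\<bar> * \<mu>) \<Longrightarrow>
    norm (?M lams) \<le> L \<and>
    norm (lagrangian_zz \<phi> g z lam - ?M lams) \<le> L * \<mu> \<and>
    norm (mat_on UNIV ?B (grad_mat g z) - G) \<le> L * \<mu> \<and>
    norm (mat_on UNIV UNIV (\<lambda>j k. \<Sum>i\<in>-?B. grad_mat g z j i * d i * grad_mat g z k i)) \<le> L * \<mu>"
    unfolding G_def
  proof (rule nlp_data_perturbation[OF assms(1,2,4) \<open>\<kappa> \<ge> 0\<close> abs_ge_zero[of CN], of "-?B" ?B], goal_cases)
    case (1 \<mu>0 L)
    show ?case by (rule 1(1)[OF 1(2-4)])
  qed
  \<comment> \<open>Covers the deviations of both off-diagonal blocks and the norm of the (2,2)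
    block; \<open>cB\<close> accounts for the filler entries of \<open>d\<close> below.\<close>
  define CT where "CT = L + \<bar>C12\<bar> + \<bar>C21\<bar> + \<bar>CB\<bar> + cB + \<bar>C22\<bar>"
  have adj: "x \<bullet> (G *v y) = (transpose G *v x) \<bullet> y" for x y
    by (simp add: transpose_matrix_vector dot_lmul_matrix)
  \<comment> \<open>Coercivity is requested with \<open>cB / 2\<close>: the other half of
    \<open>cB\<close> is reserved for the perturbation \<open>E22\<close>.\<close>
  obtain \<theta> K0 where "\<theta> > 0" "K0 > 0" and saddle: "\<And>\<mu> M T w y f h h' r1 r3 r4.
    0 < \<mu> \<Longrightarrow> \<mu> \<le> \<theta> \<Longrightarrow> linear M \<Longrightarrow> (\<And>x. norm (M x) \<le> L * norm x) \<Longrightarrow>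
    (\<And>p. transpose G *v p = 0 \<Longrightarrow> \<tau> * (norm p)\<^sup>2 \<le> p \<bullet> M p) \<Longrightarrow>
    linear T \<Longrightarrow> (\<And>q. norm (T q) \<le> CT * \<mu> * norm q) \<Longrightarrow>
    (\<And>q. cB / 2 * \<mu> * (norm q)\<^sup>2 \<le> q \<bullet> T q) \<Longrightarrow>
    norm f \<le> \<theta> * norm w \<Longrightarrow> norm h \<le> CT * \<mu> * norm y \<Longrightarrow> norm h' \<le> CT * \<mu> * norm w \<Longrightarrow>
    M w + f + (G *v y + h) = r1 \<Longrightarrow> transpose G *v (w - r3) + h' = T y + r4 \<Longrightarrow>
    norm w \<le> K0 * (norm r1 + norm r3 + norm r4) \<and>
    norm (G *v y) \<le> K0 * (norm r1 + norm r3 + norm r4) \<and>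
    norm y \<le> K0 * (norm r1 + norm r3 + norm r4 / \<mu>)"
  proof (rule saddle_point_estimate[OF matrix_vector_mul_linear[of G] matrix_vector_mul_linear[of "transpose G"]
          adj conjunct1[OF \<tau>] half_gt_zero[OF assms(5)], of L CT], goal_cases)
    case (1 \<theta> K0)
    show ?case by (rule 1(1)[OF 1(2-4)])
  qed
  obtain k where "k > 0" and k: "\<And>y r sig P Q. is_svd UNIV ?B (grad_mat g zs) r sig P Q \<Longrightarrow>
      L2_set (tmulv ?B Q y) {..<r} \<le> k * norm (G *v vec_on ?B y)"
    using row_space_component_bound[of ?B "grad_mat g zs"] unfolding G_def by blast
  define X where "X = fro_norm UNIV ?B (grad_mat g zs) + norm (?M lams0)"
  have "X \<ge> 0" by (simp add: X_def fro_norm_def)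
  \<comment> \<open>The third bound makes the part of the (1,1) deviation proportional to \<mu> at
    most \<open>\<theta> / 2\<close>.\<close>
  define \<mu>1 where "\<mu>1 = Min {\<mu>0, \<theta>, \<theta> / (2 * (2 * L + \<bar>C11\<mu>\<bar> + 1))}"
  have "\<mu>1 > 0" and \<mu>1: "\<mu>1 \<le> \<mu>0" "\<mu>1 \<le> \<theta>" "\<mu>1 \<le> \<theta> / (2 * (2 * L + \<bar>C11\<mu>\<bar> + 1))"
    using \<open>\<mu>0 > 0\<close> \<open>\<theta> > 0\<close> \<open>L > 0\<close> by (auto simp: \<mu>1_def)
  \<comment> \<open>\<open>X\<close> bounds the threshold, so a large \<open>\<beta>\<close> forces \<open>\<mu> \<le> \<mu>1\<close>.\<close>
  define \<beta>0 where "\<beta>0 = (X + 1) / \<mu>1 powr (1/3)"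
  \<comment> \<open>In turn: \<open>u \<le> \<mu>\<close>, so that multiples of \<open>u\<close> are
    of order \<mu>; the part of the (1,1) deviation proportional to \<open>u / \<mu>\<close> is at
    most \<open>\<theta> / 2\<close>; and \<open>E22\<close> has norm at most
    \<open>cB / 2 * \<mu>\<close>.\<close>
  define \<eta> where "\<eta> = Min {1, \<theta> / (2 * (\<bar>C11u\<bar> + 1)), cB / (2 * (\<bar>C22\<bar> + 1))}"
  have "\<eta> > 0" and \<eta>: "\<eta> \<le> 1" "\<eta> \<le> \<theta> / (2 * (\<bar>C11u\<bar> + 1))" "\<eta> \<le> cB / (2 * (\<bar>C22\<bar> + 1))"
    using \<open>\<theta> > 0\<close> assms(5) by (auto simp: \<eta>_def)
  have "\<beta>0 > 0" using \<open>\<mu>1 > 0\<close> \<open>X \<ge> 0\<close> by (simp add: \<beta>0_def)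
  define K where "K = k * K0 + 2 * K0"
  have "K > 0" using \<open>k > 0\<close> \<open>K0 > 0\<close> by (simp add: K_def add_pos_pos)
  show ?thesis
  proof (rule exI[of _ \<beta>0], intro conjI \<open>\<beta>0 > 0\<close>, rule exI[of _ \<eta>], intro conjI \<open>\<eta> > 0\<close>,
      rule exI[of _ K], intro conjI \<open>K > 0\<close>, unfold Let_def, intro allI impI)
    fix \<beta> \<mu> u :: real and z :: "real^'n" and lam s :: "real^'m"
      and E11 :: "'n \<Rightarrow> 'n \<Rightarrow> real" and E12 :: "'n \<Rightarrow> 'm \<Rightarrow> real"
      and E21 :: "'m \<Rightarrow> 'n \<Rightarrow> real" and E22 :: "'m \<Rightarrow> 'm \<Rightarrow> real"
      and r1 r3 :: "real^'n" and r4 :: "'m \<Rightarrow> real" and w :: "real^'n" and y :: "'m \<Rightarrow> real"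
      and r :: nat and sig :: "nat \<Rightarrow> real" and P :: "'n \<Rightarrow> nat \<Rightarrow> real" and Q :: "'m \<Rightarrow> nat \<Rightarrow> real"
    define t where "t = \<beta> * max (\<mu> powr (1/3)) (u / \<mu>)"
    assume \<beta>: "\<beta>0 \<le> \<beta>" and "0 < \<mu>" "0 \<le> u" and u\<mu>: "u / \<mu> \<le> \<eta>" and "u \<le> \<eta>"
      and dist: "sol_dist \<phi> g zs z lam \<le> C\<delta> * \<mu>"
      and DB: "\<forall>i\<in>?B. cB * \<mu> \<le> D_entry lam s i \<and> D_entry lam s i \<le> CB * \<mu>"
      and DN: "\<forall>i\<in>-?B. cN * \<mu> \<le> inverse (D_entry lam s i) \<and> inverse (D_entry lam s i) \<le> CN * \<mu>"
      and E11: "fro_norm UNIV UNIV E11 \<le> C11u * (u / \<mu>) + C11\<mu> * \<mu>"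
      and E12: "fro_norm UNIV ?B E12 \<le> C12 * u"
      and E21: "fro_norm ?B UNIV E21 \<le> C21 * u"
      and E22: "fro_norm ?B ?B E22 \<le> C22 * u"
      and sys: "perturbed_system \<phi> g zs z lam s E11 E12 E21 E22 r1 r3 r4 w y"
      and svd: "is_svd UNIV ?B (grad_mat g zs) r sig P Q"
      and "{..<r} \<noteq> {} \<longrightarrow> \<beta> * max (\<mu> powr (1/3)) (u / \<mu>) \<le> sigma_min {..<r} (diag sig)"
      and "\<forall>lams\<in>?S. {r..<CARD('n)} \<noteq> {} \<longrightarrow> \<beta> * max (\<mu> powr (1/3)) (u / \<mu>) \<le>
         sigma_min {r..<CARD('n)} (congruence UNIV (\<lambda>i j. ?M lams $ i $ j) P)"
    then have t1: "{..<r} \<noteq> {} \<Longrightarrow> t \<le> sigma_min {..<r} (diag sig)"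
      and t2: "\<And>lams. lams \<in> ?S \<Longrightarrow> {r..<CARD('n)} \<noteq> {} \<Longrightarrow>
         t \<le> sigma_min {r..<CARD('n)} (congruence UNIV (\<lambda>i j. ?M lams $ i $ j) P)"
      by (auto simp: t_def)
    have "\<beta> > 0" using \<beta> \<open>\<beta>0 > 0\<close> by simp
    have "t > 0" using \<open>\<beta> > 0\<close> \<open>0 < \<mu>\<close> by (auto simp: t_def less_max_iff_disj)
    have "coercive t"
      using coercive_on_left_null_space[OF svd sym t2] by (auto simp: coercive_def G_def)
    then have co: "coercive \<tau>" using \<tau> \<open>t > 0\<close> by blast
    have "t \<le> X"
      unfolding X_def using svd_thresholds_bounded[OF svd sym t1 t2[OF lams0]] .
    have "\<mu> \<le> \<mu>1"
    proof (rule ccontr)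
      assume "\<not> \<mu> \<le> \<mu>1"
      \<comment> \<open>The left side equals \<open>X + 1\<close>, whereas the threshold on the
        right is at most \<open>X\<close>.\<close>
      then have "\<beta>0 * \<mu>1 powr (1/3) \<le> \<beta> * max (\<mu> powr (1/3)) (u / \<mu>)"
        using \<beta> \<open>\<beta> > 0\<close> \<open>\<mu>1 > 0\<close> by (intro mult_mono max.coboundedI1 powr_mono2) auto
      then show False using \<open>t \<le> X\<close> \<open>\<mu>1 > 0\<close> by (simp add: \<beta>0_def t_def)
    qed
    then have \<mu>: "\<mu> \<le> \<mu>0" "\<mu> \<le> \<theta>" "\<mu> \<le> \<theta> / (2 * (2 * L + \<bar>C11\<mu>\<bar> + 1))"
      using \<mu>1 by auto
    have "u \<le> \<eta> * \<mu>" using u\<mu> \<open>0 < \<mu>\<close> by (simp add: field_simps)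
    also have "\<dots> \<le> \<mu>" using \<eta>(1) \<open>0 < \<mu>\<close> by simp
    finally have "u \<le> \<mu>" .
    have scale: "C * u \<le> \<bar>C\<bar> * \<mu>" for C :: real
      using \<open>u \<le> \<mu>\<close> \<open>0 \<le> u\<close> by (intro mult_mono) auto
    have "sol_dist \<phi> g zs z lam < \<kappa> * \<mu>"
      using dist \<open>0 < \<mu>\<close> by (smt (verit) \<kappa>_def mult_strict_right_mono)
    then obtain lams where lams: "lams \<in> ?S" "norm (z - zs) \<le> \<kappa> * \<mu>" "norm (lam - lams) \<le> \<kappa> * \<mu>"
      using sol_dist_nearby_multiplier[OF assms(3)] by blast

    \<comment> \<open>Reduction to the saddle point estimate\<close>
    define N where "N = mat_on UNIV UNIV (\<lambda>j k. \<Sum>i\<in>-?B.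
      grad_mat g z j i * inverse (D_entry lam s i) * grad_mat g z k i)"
    define Gz where "Gz = mat_on UNIV ?B (grad_mat g z)"
    define Mz where "Mz = lagrangian_zz \<phi> g z lam"
    have "0 \<le> inverse (D_entry lam s i) \<and> inverse (D_entry lam s i) \<le> \<bar>CN\<bar> * \<mu>" if "i \<in> -?B" for i
    proof -
      have "0 \<le> cN * \<mu>" "CN * \<mu> \<le> \<bar>CN\<bar> * \<mu>"
        using assms(6) \<open>0 < \<mu>\<close> by (auto intro: mult_right_mono)
      then show ?thesis using bspec[OF DN that] by linarith
    qed
    then have bounds: "norm (?M lams) \<le> L" "norm (Mz - ?M lams) \<le> L * \<mu>" "norm (Gz - G) \<le> L * \<mu>"
      "norm N \<le> L * \<mu>"
      using pert[OF \<open>0 < \<mu>\<close> \<mu>(1) lams, of "\<lambda>i. inverse (D_entry lam s i)"]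
      unfolding N_def Gz_def Mz_def by blast+
    \<comment> \<open>\<open>F\<close>, \<open>H\<close> and \<open>H'\<close> are the total
      deviations of three blocks from the Hessian at \<open>lams\<close>, from \<open>G\<close> and
      from its transpose.\<close>
    define F where "F = (Mz - ?M lams) + N + mat_on UNIV UNIV E11"
    define H where "H = (Gz - G) + mat_on UNIV ?B E12"
    define H' where "H' = transpose (Gz - G) + mat_on ?B UNIV E21"
    \<comment> \<open>The saddle point estimate needs \<open>T\<close> coercive on all of
      \<open>real^'m\<close>, padded coordinates included. The filler \<open>cB * \<mu>\<close>
      ensures this and leaves the equation unchanged, since the padded \<open>y\<close> vanishes
      there.\<close>
    define d where "d i = (if i \<in> ?B then D_entry lam s i else cB * \<mu>)" for i
    define E where "E = mat_on ?B ?B E22"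
    define T where "T q = vec_on UNIV (\<lambda>i. d i * q $ i) - E *v q" for q
    have d: "cB * \<mu> \<le> d i" "\<bar>d i\<bar> \<le> (\<bar>CB\<bar> + cB) * \<mu>" for i
    proof -
      have "CB * \<mu> \<le> \<bar>CB\<bar> * \<mu>" "0 < cB * \<mu>" "0 \<le> \<bar>CB\<bar> * \<mu>"
        using \<open>0 < \<mu>\<close> assms(5) by (auto intro: mult_right_mono)
      then show "cB * \<mu> \<le> d i" "\<bar>d i\<bar> \<le> (\<bar>CB\<bar> + cB) * \<mu>"
        using DB by (force simp: d_def distrib_right)+
    qed
    have nE: "norm E \<le> \<bar>C22\<bar> * u"
      using E22 mult_right_mono[OF abs_ge_self[of C22] \<open>0 \<le> u\<close>] by (simp add: E_def norm_mat_on)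
    have "norm w \<le> K0 * (norm r1 + norm r3 + norm (vec_on ?B r4)) \<and>
      norm (G *v vec_on ?B y) \<le> K0 * (norm r1 + norm r3 + norm (vec_on ?B r4)) \<and>
      norm (vec_on ?B y) \<le> K0 * (norm r1 + norm r3 + norm (vec_on ?B r4) / \<mu>)"
    proof (rule saddle[of \<mu> "(*v) (?M lams)" T "F *v w" _ "H *v vec_on ?B y" _ "H' *v w"])
      show "norm (?M lams *v x) \<le> L * norm x" for x
        using norm_matrix_vector_mult_le bounds(1) by (meson mult_right_mono norm_ge_zero order_trans)
      show "\<tau> * (norm p)\<^sup>2 \<le> p \<bullet> (?M lams *v p)" if "transpose G *v p = 0" for p
        using co lams(1) that by (auto simp: coercive_def)
      have "linear (\<lambda>q. vec_on UNIV (\<lambda>i. d i * q $ i))"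
        by (auto intro!: linearI simp: vec_on_def vec_eq_iff algebra_simps)
      then show "linear T" unfolding T_def by (intro linear_compose_sub matrix_vector_mul_linear)
      show "norm (T q) \<le> CT * \<mu> * norm q" for q
      proof -
        have "norm (vec_on UNIV (\<lambda>i. d i * q $ i)) \<le> L2_set (\<lambda>i. (\<bar>CB\<bar> + cB) * \<mu> * \<bar>q $ i\<bar>) UNIV"
          unfolding norm_vec_on L2_set_def
        proof (intro real_sqrt_le_mono sum_mono)
          fix i
          have "\<bar>d i * q $ i\<bar> \<le> (\<bar>CB\<bar> + cB) * \<mu> * \<bar>q $ i\<bar>"
            using d(2)[of i] by (simp add: abs_mult mult_right_mono)
          then show "(d i * q $ i)\<^sup>2 \<le> ((\<bar>CB\<bar> + cB) * \<mu> * \<bar>q $ i\<bar>)\<^sup>2"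
            by (rule abs_le_square_iff[THEN iffD1, OF order_trans[OF _ abs_ge_self]])
        qed
        also have "\<dots> = (\<bar>CB\<bar> + cB) * \<mu> * norm q"
          using assms(5) \<open>0 < \<mu>\<close> by (simp add: norm_vec_def L2_set_right_distrib)
        finally have a: "norm (vec_on UNIV (\<lambda>i. d i * q $ i)) \<le> (\<bar>CB\<bar> + cB) * \<mu> * norm q" .
        have b: "norm (E *v q) \<le> \<bar>C22\<bar> * \<mu> * norm q"
          using norm_matrix_vector_mult_le[of E q] nE scale[of "\<bar>C22\<bar>"]
          by (smt (verit) abs_idempotent mult_right_mono norm_ge_zero)
        have "norm (T q) \<le> (\<bar>CB\<bar> + cB + \<bar>C22\<bar>) * \<mu> * norm q"
          unfolding T_def using a b norm_triangle_ineq4[of "vec_on UNIV (\<lambda>i. d i * q $ i)" "E *v q"]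
          by (simp add: distrib_right)
        also have "\<dots> \<le> CT * \<mu> * norm q"
          using \<open>L > 0\<close> \<open>0 < \<mu>\<close> by (intro mult_right_mono) (auto simp: CT_def)
        finally show ?thesis .
      qed
      show "cB / 2 * \<mu> * (norm q)\<^sup>2 \<le> q \<bullet> T q" for q
      proof -
        have "cB * \<mu> * (norm q)\<^sup>2 = (\<Sum>i\<in>UNIV. cB * \<mu> * (q $ i)\<^sup>2)"
          by (simp add: norm_vec_def L2_set_def sum_nonneg sum_distrib_left)
        also have "\<dots> \<le> (\<Sum>i\<in>UNIV. d i * (q $ i)\<^sup>2)"
          using d(1) by (intro sum_mono mult_right_mono) auto
        also have "\<dots> = q \<bullet> vec_on UNIV (\<lambda>i. d i * q $ i)"
          by (simp add: inner_vec_def vec_on_def power2_eq_square ac_simps)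
        finally have a: "cB * \<mu> * (norm q)\<^sup>2 \<le> q \<bullet> vec_on UNIV (\<lambda>i. d i * q $ i)" .
        have "\<bar>C22\<bar> * u \<le> \<bar>C22\<bar> * (cB / (2 * (\<bar>C22\<bar> + 1)) * \<mu>)"
          using \<open>u \<le> \<eta> * \<mu>\<close> mult_right_mono[OF \<eta>(3), of \<mu>] \<open>0 < \<mu>\<close> by (intro mult_left_mono) auto
        also have "\<dots> \<le> cB / 2 * \<mu>"
          using assms(5) \<open>0 < \<mu>\<close> by (simp add: field_simps)
        finally have "norm E \<le> cB / 2 * \<mu>" using nE by simp
        have "q \<bullet> (E *v q) \<le> norm q * norm (E *v q)" by (rule norm_cauchy_schwarz)
        also have "\<dots> \<le> norm q * (cB / 2 * \<mu> * norm q)"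
          using norm_matrix_vector_mult_le[of E q] mult_right_mono[OF \<open>norm E \<le> cB / 2 * \<mu>\<close> norm_ge_zero[of q]]
          by (intro mult_left_mono) auto
        finally have "q \<bullet> (E *v q) \<le> cB / 2 * \<mu> * (norm q)\<^sup>2"
          by (simp add: power2_eq_square ac_simps)
        then show ?thesis
          using a by (simp add: T_def inner_diff_right)
      qed
      have "norm F \<le> \<theta>"
      proof -
        have "norm F \<le> L * \<mu> + L * \<mu> + (C11u * (u / \<mu>) + C11\<mu> * \<mu>)"
          unfolding F_def using bounds E11 norm_triangle_ineq[of "Mz - ?M lams + N" "mat_on UNIV UNIV E11"]
            norm_triangle_ineq[of "Mz - ?M lams" N] by (simp add: norm_mat_on)
        also have "\<dots> \<le> (2 * L + \<bar>C11\<mu>\<bar> + 1) * \<mu> + (\<bar>C11u\<bar> + 1) * (u / \<mu>)"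
        proof -
          have "0 \<le> u / \<mu>" using \<open>0 < \<mu>\<close> \<open>0 \<le> u\<close> by simp
          then have "C11u * (u / \<mu>) \<le> \<bar>C11u\<bar> * (u / \<mu>)" "C11\<mu> * \<mu> \<le> \<bar>C11\<mu>\<bar> * \<mu>"
            using \<open>0 < \<mu>\<close> by (intro mult_right_mono; simp)+
          then show ?thesis
            using \<open>0 \<le> u / \<mu>\<close> \<open>0 < \<mu>\<close> unfolding distrib_right by linarith
        qed
        also have "\<dots> \<le> (2 * L + \<bar>C11\<mu>\<bar> + 1) * (\<theta> / (2 * (2 * L + \<bar>C11\<mu>\<bar> + 1))) +
            (\<bar>C11u\<bar> + 1) * (\<theta> / (2 * (\<bar>C11u\<bar> + 1)))"
          using \<mu>(3) order_trans[OF u\<mu> \<eta>(2)] \<open>L > 0\<close> by (intro add_mono mult_left_mono) auto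
        also have "\<dots> = \<theta>"
        proof -
          have half: "a * (\<theta> / (2 * a)) = \<theta> / 2" if "a > 0" for a using that by simp
          have "2 * L + \<bar>C11\<mu>\<bar> + 1 > 0" "\<bar>C11u\<bar> + 1 > 0" using \<open>L > 0\<close> by auto
          then show ?thesis by (simp only: half)
        qed
        finally show ?thesis .
      qed
      then show "norm (F *v w) \<le> \<theta> * norm w"
        using norm_matrix_vector_mult_le by (meson mult_right_mono norm_ge_zero order_trans)
      have CT: "(L + \<bar>C12\<bar>) * \<mu> \<le> CT * \<mu>" "(L + \<bar>C21\<bar>) * \<mu> \<le> CT * \<mu>"
        using assms(5) \<open>0 < \<mu>\<close> by (auto simp: CT_def intro!: mult_right_mono)
      have "norm H \<le> CT * \<mu>"
        using norm_triangle_ineq[of "Gz - G" "mat_on UNIV ?B E12"] bounds(3) E12 scale[of C12] CT(1)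
        by (simp add: H_def norm_mat_on distrib_right)
      then show "norm (H *v vec_on ?B y) \<le> CT * \<mu> * norm (vec_on ?B y)"
        using norm_matrix_vector_mult_le by (meson mult_right_mono norm_ge_zero order_trans)
      have "norm H' \<le> CT * \<mu>"
        using norm_triangle_ineq[of "transpose (Gz - G)" "mat_on ?B UNIV E21"] bounds(3) E21 scale[of C21] CT(2)
        by (simp add: H'_def norm_mat_on norm_transpose distrib_right)
      then show "norm (H' *v w) \<le> CT * \<mu> * norm w"
        using norm_matrix_vector_mult_le by (meson mult_right_mono norm_ge_zero order_trans)
      have "?M lams + F = Mz + N + mat_on UNIV UNIV E11" "G + H = Gz + mat_on UNIV ?B E12"
        by (simp_all add: F_def H_def)
      then show "?M lams *v w + F *v w + (G *v vec_on ?B y + H *v vec_on ?B y) = r1"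
        using perturbed_system_vector_form(1)[OF sys refl]
        by (simp add: N_def Gz_def Mz_def matrix_vector_mult_add_rdistrib[symmetric])
      have Ty: "T (vec_on ?B y) = vec_on ?B (\<lambda>i. D_entry lam s i * y i) - E *v vec_on ?B y"
        by (auto simp: T_def vec_on_def d_def vec_eq_iff)
      have tr: "transpose Gz = transpose G + transpose (Gz - G)"
        by (simp add: transpose_def vec_eq_iff)
      have "(transpose Gz + mat_on ?B UNIV E21) *v w - T (vec_on ?B y)
          = transpose G *v r3 + vec_on ?B r4"
        using perturbed_system_vector_form(2)[OF sys refl]
        by (simp add: Ty G_def Gz_def E_def algebra_simps)
      then show "transpose G *v (w - r3) + H' *v w = T (vec_on ?B y) + vec_on ?B r4"
        unfolding tr by (simp add: H'_def matrix_vector_mult_add_rdistrib matrix_vector_mult_diff_distrib algebra_simps)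
    qed (use \<open>0 < \<mu>\<close> \<mu> in \<open>auto intro: matrix_vector_mul_linear\<close>)
    then have w: "norm w \<le> K0 * (norm r1 + norm r3 + L2_set r4 ?B)"
      and Gy: "norm (G *v vec_on ?B y) \<le> K0 * (norm r1 + norm r3 + L2_set r4 ?B)"
      and y: "L2_set y ?B \<le> K0 * (norm r1 + norm r3 + L2_set r4 ?B / \<mu>)"
      by (simp_all add: norm_vec_on)

    \<comment> \<open>Passage to singular coordinates\<close>
    have "L2_set (($) w) UNIV = norm w" using norm_vec_on[of UNIV "($) w"] by simp
    then have Pw: "L2_set (tmulv UNIV P (($) w)) I \<le> norm w" if "I \<subseteq> {..<CARD('n)}" for I
      using Bessel_orthogonal_on[of UNIV "{..<CARD('n)}" P I "($) w"] svd that by (simp add: is_svd_def)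
    have "r \<le> CARD('n)" using svd by (simp add: is_svd_def)
    let ?\<rho> = "norm r1 + norm r3 + L2_set r4 ?B"
    let ?a = "L2_set (tmulv ?B Q y) {..<r}" and ?b = "L2_set (tmulv UNIV P (($) w)) {r..<CARD('n)}"
      and ?c = "L2_set (tmulv UNIV P (($) w)) {..<r}"
    have "norm (?a, ?b, ?c) \<le> ?a + (?b + ?c)"
      using norm_Pair_le[of ?a "(?b, ?c)"] norm_Pair_le[of ?b ?c] by simp
    also have "\<dots> \<le> k * (K0 * ?\<rho>) + (K0 * ?\<rho> + K0 * ?\<rho>)"
    proof (intro add_mono)
      \<comment> \<open>Going through \<open>G *v vec_on ?B y\<close> rather than \<open>y\<close>
        itself keeps the division of \<open>r4\<close> by \<mu> out of this component.\<close>
      show "?a \<le> k * (K0 * ?\<rho>)"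
        using k[OF svd, of y] mult_left_mono[OF Gy less_imp_le[OF \<open>k > 0\<close>]] by (rule order_trans)
      show "?b \<le> K0 * ?\<rho>" by (rule order_trans[OF Pw w]) auto
      show "?c \<le> K0 * ?\<rho>" by (rule order_trans[OF Pw w]) (use \<open>r \<le> CARD('n)\<close> in auto)
    qed
    also have "\<dots> = K * ?\<rho>" by (simp add: K_def algebra_simps)
    finally have first: "norm (?a, ?b, ?c) \<le> K * ?\<rho>" .
    have "L2_set (tmulv ?B Q y) {r..<card ?B} \<le> L2_set y ?B"
      using svd by (intro Bessel_orthogonal_on[where L = "{..<card ?B}"]) (auto simp: is_svd_def)
    also have "\<dots> \<le> K0 * (norm r1 + norm r3 + L2_set r4 ?B / \<mu>)" by (rule y)
    also have "\<dots> \<le> K * (norm r1 + norm r3 + L2_set r4 ?B / \<mu>)"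
      using \<open>k > 0\<close> \<open>K0 > 0\<close> \<open>0 < \<mu>\<close> by (intro mult_right_mono) (auto simp: K_def)
    finally show "norm (?a, ?b, ?c) \<le> K * (norm r1 + norm r3 + L2_set r4 ?B) \<and>
        L2_set (tmulv ?B Q y) {r..<card ?B} \<le> K * (norm r1 + norm r3 + L2_set r4 ?B / \<mu>)"
      using first by blast
  qed
qed

end
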